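(* Let $R$ be a $d\times d$ expansive integer matrix, let $B\subset\mathbb{Z}^d$ with $\#B=N\ge 2$, let $\tau_b(x)=R^{-1}(x+b)$ for $b\in B$, and let $\mu=\mu_B$ be the invariant measure of the iterated function system $(\tau_b)_{b\in B}$. Assume that $\mu$ has no overlap. Let $\Lambda$ be a discrete subset of $\mathbb{R}^d$. Let $r_0>0$ and $\delta>0$ be such that $|\widehat\mu(x)|\ge\delta$ for $|x|\le r_0$. For $n\in\mathbb{N}$ define $$\Lambda_n(r_0):=\{\lambda\in\Lambda: |(R^T)^{-n}\lambda|\le r_0\},\qquad A_n:=\frac{1}{\sqrt{N^n}}\left(e^{-2\pi i\lambda\cdot\tau_k(0)}\right)_{\lambda\in\Lambda_n(r_0),\,k\in B^n}.$$ Suppose there exist constants $m,M>0$ such that $$m\|f\|^2\le\|A_nf\|^2\le M\|f\|^2$$ for all $f\in\mathbb{C}^{\#B^n}$ and all $n\in\mathbb{N}$. Then $\Lambda$ is a frame spectrum for $\mu$.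
   Context: A matrix is expansive if all its eigenvalues have modulus greater than $1$. $\mu_B$ is the unique Borel probability measure on $\mathbb{R}^d$ with $\int f\,d\mu_B=\frac1N\sum_{b\in B}\int f\circ\tau_b\,d\mu_B$ for all continuous functions $f$ on $\mathbb R^d$. $X_B$ is the attractor of the IFS, i.e. the unique nonempty compact set with $X_B=\bigcup_{b\in B}\tau_b(X_B)$. The measure $\mu_B$ has no overlap if $\mu_B(\tau_b(X_B)\cap\tau_{b'}(X_B))=0$ for all $b\ne b'$ in $B$. For $k=(k_1,\dots,k_n)\in B^n$, $\tau_k:=\tau_{k_n}\circ\dots\circ\tau_{k_1}$. $\widehat\mu(x)=\int e^{2\pi i x\cdot t}\,d\mu(t)$. $|\cdot|$ is the Euclidean norm, and the norms of vectors in $\mathbb{C}^{\#B^n}$ (indexed by $B^n$) and of $A_nf$ are $\ell^2$ norms. With $e_\lambda(x)=e^{2\pi i\lambda\cdot x}$, a set $\Lambda\subset\mathbb{R}^d$ is a frame spectrum for $\mu$ if $(e_\lambda)_{\lambda\in\Lambda}$ is a frame for $L^2(\mu)$: there are constants $a,b>0$ with $a\|v\|^2\le\sum_{\lambda\in\Lambda}|\langle v,e_\lambda\rangle|^2\le b\|v\|^2$ for all $v\in L^2(\mu)$. *)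

theory Defs
  imports "HOL-Probability.Probability"
begin

definition integer_matrix :: "real ^ 'd ^ 'd \<Rightarrow> bool" where
  "integer_matrix R \<longleftrightarrow> (\<forall>i j. R $ i $ j \<in> \<int>)"

definition integer_vector :: "real ^ 'd \<Rightarrow> bool" where
  "integer_vector x \<longleftrightarrow> (\<forall>i. x $ i \<in> \<int>)"

text \<open>The eigenvalues are the complex ones, hence the passage to a complex matrix.\<close>

definition expansive :: "real ^ 'd ^ 'd \<Rightarrow> bool" where
  "expansive R \<longleftrightarrow>
    (\<forall>z v. v \<noteq> 0 \<and> map_matrix complex_of_real R *v v = z *s v \<longrightarrow> cmod z > 1)"

definition ifs_map :: "real ^ 'd ^ 'd \<Rightarrow> real ^ 'd \<Rightarrow> real ^ 'd \<Rightarrow> real ^ 'd" where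
  "ifs_map R b x = matrix_inv R *v (x + b)"

text \<open>Words \<open>(k\<^sub>1, \<dots>, k\<^sub>n)\<close> over \<open>B\<close> are lists; \<open>fold\<close> applies the
  map of \<open>k\<^sub>1\<close> first and that of \<open>k\<^sub>n\<close> last.\<close>

definition words :: "'a set \<Rightarrow> nat \<Rightarrow> 'a list set" where
  "words B n = {k. length k = n \<and> set k \<subseteq> B}"

definition ifs_word :: "real ^ 'd ^ 'd \<Rightarrow> (real ^ 'd) list \<Rightarrow> real ^ 'd \<Rightarrow> real ^ 'd" where
  "ifs_word R k x = fold (ifs_map R) k x"

text \<open>The following two predicates determine \<open>\<mu>\<close> and \<open>X\<close> uniquely when \<open>R\<close> is
  expansive and \<open>B\<close> is finite and nonempty.  The invariant measure has compact support, so
  every continuous \<open>f\<close> is integrable for it; the bounded \<open>f\<close> alone already single it out,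
  so the value \<open>0\<close> that the library gives to non-integrable functions plays no role.\<close>

definition invariant_measure ::
  "real ^ 'd ^ 'd \<Rightarrow> (real ^ 'd) set \<Rightarrow> (real ^ 'd) measure \<Rightarrow> bool" where
  "invariant_measure R B \<mu> \<longleftrightarrow>
     prob_space \<mu> \<and> sets \<mu> = sets borel \<and>
     (\<forall>f :: real ^ 'd \<Rightarrow> real. continuous_on UNIV f \<longrightarrow>
        (LINT x|\<mu>. f x) = 1 / real (card B) * (\<Sum>b\<in>B. LINT x|\<mu>. f (ifs_map R b x)))"

definition attractor :: "real ^ 'd ^ 'd \<Rightarrow> (real ^ 'd) set \<Rightarrow> (real ^ 'd) set \<Rightarrow> bool" where
  "attractor R B X \<longleftrightarrow> X \<noteq> {} \<and> compact X \<and> X = (\<Union>b\<in>B. ifs_map R b ` X)"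

text \<open>Here \<open>X\<close> is the attractor of the iterated function system.\<close>

definition no_overlap ::
  "real ^ 'd ^ 'd \<Rightarrow> (real ^ 'd) set \<Rightarrow> (real ^ 'd) set \<Rightarrow> (real ^ 'd) measure \<Rightarrow> bool" where
  "no_overlap R B X \<mu> \<longleftrightarrow>
     (\<forall>b\<in>B. \<forall>b'\<in>B. b \<noteq> b' \<longrightarrow> measure \<mu> (ifs_map R b ` X \<inter> ifs_map R b' ` X) = 0)"

definition expo :: "real ^ 'd \<Rightarrow> real ^ 'd \<Rightarrow> complex" where
  "expo l x = exp (2 * pi * \<i> * of_real (l \<bullet> x))"

definition fourier_transform :: "(real ^ 'd) measure \<Rightarrow> real ^ 'd \<Rightarrow> complex" where
  "fourier_transform \<mu> x = (LINT t|\<mu>. exp (2 * pi * \<i> * of_real (x \<bullet> t)))"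

definition square_integrable :: "'a measure \<Rightarrow> ('a \<Rightarrow> complex) \<Rightarrow> bool" where
  "square_integrable \<mu> v \<longleftrightarrow>
     v \<in> borel_measurable \<mu> \<and> integrable \<mu> (\<lambda>x. (cmod (v x))\<^sup>2)"

definition L2_norm_sq :: "'a measure \<Rightarrow> ('a \<Rightarrow> complex) \<Rightarrow> real" where
  "L2_norm_sq \<mu> v = (LINT x|\<mu>. (cmod (v x))\<^sup>2)"

definition L2_inner :: "'a measure \<Rightarrow> ('a \<Rightarrow> complex) \<Rightarrow> ('a \<Rightarrow> complex) \<Rightarrow> complex" where
  "L2_inner \<mu> v w = (LINT x|\<mu>. v x * cnj (w x))"

text \<open>Sums over possibly infinite sets of frequencies are taken in the extended nonnegative
  reals, so that an upper bound includes convergence.\<close>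

definition frame_spectrum :: "(real ^ 'd) measure \<Rightarrow> (real ^ 'd) set \<Rightarrow> bool" where
  "frame_spectrum \<mu> \<Lambda> \<longleftrightarrow>
     (\<exists>a b :: real. a > 0 \<and> b > 0 \<and>
       (\<forall>v. square_integrable \<mu> v \<longrightarrow>
          ennreal (a * L2_norm_sq \<mu> v)
            \<le> (\<Sum>\<^sub>\<infinity>l\<in>\<Lambda>. ennreal ((cmod (L2_inner \<mu> v (expo l)))\<^sup>2)) \<and>
          (\<Sum>\<^sub>\<infinity>l\<in>\<Lambda>. ennreal ((cmod (L2_inner \<mu> v (expo l)))\<^sup>2))
            \<le> ennreal (b * L2_norm_sq \<mu> v)))"

definition Lambda_n ::
  "real ^ 'd ^ 'd \<Rightarrow> (real ^ 'd) set \<Rightarrow> real \<Rightarrow> nat \<Rightarrow> (real ^ 'd) set" where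
  "Lambda_n R \<Lambda> r0 n = {l \<in> \<Lambda>. norm (((\<lambda>x. matrix_inv (transpose R) *v x) ^^ n) l) \<le> r0}"

text \<open>The entry of \<open>A\<^sub>n\<close> in row \<open>l\<close> and column \<open>k\<close>, for \<open>l\<close> in \<open>Lambda_n R \<Lambda> r0 n\<close>
  and \<open>k\<close> in \<open>words B n\<close>.\<close>

definition A_entry ::
  "real ^ 'd ^ 'd \<Rightarrow> (real ^ 'd) set \<Rightarrow> nat \<Rightarrow> real ^ 'd \<Rightarrow> (real ^ 'd) list \<Rightarrow> complex" where
  "A_entry R B n l k =
     1 / of_real (sqrt (real (card B) ^ n)) * exp (- 2 * pi * \<i> * of_real (l \<bullet> ifs_word R k 0))"

text \<open>A vector indexed by the words of length \<open>n\<close> is a function on lists, of which only the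
  values on \<open>words B n\<close> are used.\<close>

definition A_apply ::
  "real ^ 'd ^ 'd \<Rightarrow> (real ^ 'd) set \<Rightarrow> nat \<Rightarrow> ((real ^ 'd) list \<Rightarrow> complex) \<Rightarrow> real ^ 'd \<Rightarrow> complex"
  where
  "A_apply R B n f l = (\<Sum>k\<in>words B n. A_entry R B n l k * f k)"

definition A_norm_sq ::
  "real ^ 'd ^ 'd \<Rightarrow> (real ^ 'd) set \<Rightarrow> (real ^ 'd) set \<Rightarrow> real \<Rightarrow> nat \<Rightarrow>
     ((real ^ 'd) list \<Rightarrow> complex) \<Rightarrow> ennreal" where
  "A_norm_sq R B \<Lambda> r0 n f =
     (\<Sum>\<^sub>\<infinity>l\<in>Lambda_n R \<Lambda> r0 n. ennreal ((cmod (A_apply R B n f l))\<^sup>2))"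

definition word_norm_sq :: "'a set \<Rightarrow> nat \<Rightarrow> ('a list \<Rightarrow> complex) \<Rightarrow> real" where
  "word_norm_sq B n f = (\<Sum>k\<in>words B n. (cmod (f k))\<^sup>2)"

end

theory Submission
  imports Defs "HOL-Computational_Algebra.Fundamental_Theorem_Algebra"
begin

text \<open>
  The maps \<open>\<tau>\<^sub>k\<close>, for words \<open>k\<close> of length \<open>n\<close>, cut the attractor \<open>X\<close>
  into cells \<open>\<tau>\<^sub>k(X)\<close>. Since there is no overlap, these cells are disjoint up to null sets, each has
  measure \<open>N\<^sup>-\<^sup>n\<close>, and on each of them \<open>\<mu>\<close> is the rescaled image of \<open>\<mu>\<close> under \<open>\<tau>\<^sub>k\<close>. Since
  \<open>\<tau>\<^sub>k(x) = R\<^sup>-\<^sup>n x + \<tau>\<^sub>k(0)\<close>, the step function \<open>s\<close> with value \<open>f\<^sub>k\<close> on the cell \<open>\<tau>\<^sub>k(X)\<close> satisfies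
  \<open>\<parallel>s\<parallel>\<^sup>2 = N\<^sup>-\<^sup>n \<parallel>f\<parallel>\<^sup>2\<close> and
  \<open>\<bar>\<langle>s, e\<^sub>l\<rangle>\<bar>\<^sup>2 = N\<^sup>-\<^sup>n \<bar>(A\<^sub>n f)\<^sub>l\<bar>\<^sup>2 \<bar>\<mu>'((R\<^sup>T)\<^sup>-\<^sup>n l)\<bar>\<^sup>2\<close>,
  where \<open>\<mu>'\<close> is the Fourier transform of \<open>\<mu>\<close> (\<open>L2_norm_sq_step\<close>, \<open>L2_inner_step\<close>). For \<open>l\<close> in
  \<open>\<Lambda>\<^sub>n(r\<^sub>0)\<close> the last factor lies between \<open>\<delta>\<^sup>2\<close> and \<open>1\<close>, so the bounds on \<open>A\<^sub>n\<close> are frame bounds for step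
  functions of level \<open>n\<close> and the frequencies in \<open>\<Lambda>\<^sub>n(r\<^sub>0)\<close> (\<open>step_upper_bound\<close>,
  \<open>step_lower_bound\<close>).

  It remains to pass to all of \<open>L\<^sup>2(\<mu>)\<close> and to all of \<open>\<Lambda>\<close>. Every \<open>l\<close> in \<open>\<Lambda>\<close> belongs to
  \<open>\<Lambda>\<^sub>n(r\<^sub>0)\<close> for all large \<open>n\<close>, because \<open>(R\<^sup>T)\<^sup>-\<^sup>n l\<close> tends to \<open>0\<close>; and every square-integrable function
  is approximated by step functions of level \<open>n\<close> for all large \<open>n\<close>, because the cells shrink
  (\<open>step_approximable_square_integrable\<close>). The upper bound follows for each finite part of \<open>\<Lambda>\<close>,
  hence for \<open>\<Lambda>\<close>; with the upper bound applied to the approximation error, the lower bound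
  carries over as well. The crude inequality \<open>\<bar>a + b\<bar>\<^sup>2 \<le> 2\<bar>a\<bar>\<^sup>2 + 2\<bar>b\<bar>\<^sup>2\<close> suffices, at the price of
  the frame constants \<open>\<delta>\<^sup>2 m / 4\<close> and \<open>4 M\<close>.

  The analytic input about \<open>R\<close> is that the powers of \<open>R\<^sup>-\<^sup>1\<close> tend to \<open>0\<close>
  (\<open>expansive_inverse_powers_tendsto_zero\<close>). Invariance of \<open>\<mu>\<close> is assumed for continuous functions
  only and has to be extended to integrable ones (\<open>integral_invariant_words\<close>), since step functions are
  not continuous; the same lemma shows that \<open>\<mu>\<close> lives on \<open>X\<close> (\<open>AE_in_X\<close>).
\<close>

section \<open>Powers of a matrix with eigenvalues in the open unit disc\<close>

text \<open>From an index \<open>K\<close> on, the perturbation is so small that, beyond the geometrically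
  decaying part, the errors sum to at most \<open>e / 2\<close>.\<close>

lemma tendsto_zero_of_contractive_recurrence:
  fixes u w :: "nat \<Rightarrow> complex ^ 'n"
  assumes w: "w \<longlonglongrightarrow> 0" and z: "cmod z < 1"
    and rec: "\<And>k. u (Suc k) = z *s u k + w k"
  shows "u \<longlonglongrightarrow> 0"
proof -
  have rec': "norm (u (Suc k)) \<le> cmod z * norm (u k) + norm (w k)" for k
  proof -
    have "norm (z *s u k) = cmod z * norm (u k)"
      by (simp add: norm_vec_def L2_set_def norm_mult power_mult_distrib real_sqrt_mult flip: sum_distrib_left)
    then show ?thesis
      using norm_triangle_ineq[of "z *s u k" "w k"] by (simp add: rec)
  qed
  have "\<exists>K. \<forall>k\<ge>K. norm (u k) < e" if "e > 0" for e
  proof -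
    define q where "q = cmod z"
    have q: "0 \<le> q" "q < 1" using z by (auto simp: q_def)
    \<comment> \<open>With this choice \<open>e / 2\<close> is the fixed point of \<open>t \<mapsto> q * t + c\<close>.\<close>
    define c where "c = e / 2 * (1 - q)"
    have "c > 0" using q that by (simp add: c_def)
    then obtain K where K: "\<And>k. k \<ge> K \<Longrightarrow> norm (w k) < c"
      using w by (metis LIMSEQ_D diff_zero)
    have bound: "norm (u (K + j)) \<le> q ^ j * norm (u K) + e / 2" for j
    proof (induction j)
      case 0
      show ?case using \<open>e > 0\<close> by simp
    next
      case (Suc j)
      have "norm (u (K + Suc j)) \<le> q * norm (u (K + j)) + c"
        using rec'[of "K + j"] K[of "K + j"] by (simp add: q_def)
      also have "\<dots> \<le> q * (q ^ j * norm (u K) + e / 2) + c"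
        using Suc q by (simp add: mult_left_mono)
      also have "\<dots> = q ^ Suc j * norm (u K) + e / 2"
        by (simp add: c_def field_simps)
      finally show ?case .
    qed
    have "(\<lambda>j. q ^ j * norm (u K)) \<longlonglongrightarrow> 0"
      using tendsto_mult_left_zero[OF LIMSEQ_realpow_zero[OF q]] .
    then obtain J where J: "\<And>j. j \<ge> J \<Longrightarrow> \<bar>q ^ j * norm (u K)\<bar> < e / 2"
      using LIMSEQ_D[of _ 0 "e / 2"] \<open>e > 0\<close> by fastforce
    have "norm (u k) < e" if "k \<ge> K + J" for k
    proof -
      have "J \<le> k - K" "K + (k - K) = k" using that by auto
      then show ?thesis using bound[of "k - K"] J[of "k - K"] by simp
    qed
    then show ?thesis by blast
  qed
  then show ?thesis by (auto simp: LIMSEQ_iff)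
qed

text \<open>The vector \<open>p(A) v\<close>, evaluated by Horner's scheme.\<close>

definition poly_apply :: "complex poly \<Rightarrow> complex ^ 'n ^ 'n \<Rightarrow> complex ^ 'n \<Rightarrow> complex ^ 'n" where
  "poly_apply p A v = fold_coeffs (\<lambda>a w. a *s v + A *v w) p 0"

lemma poly_apply_0 [simp]: "poly_apply 0 A v = 0"
  by (simp add: poly_apply_def)

lemma poly_apply_pCons [simp]: "poly_apply (pCons a p) A v = a *s v + A *v poly_apply p A v"
  by (cases "p = 0 \<and> a = 0") (auto simp: poly_apply_def)

lemma poly_apply_add: "poly_apply (p + q) A v = poly_apply p A v + poly_apply q A v"
proof (induction p q rule: poly_induct2)
  case (pCons a p b q)
  then show ?case by (simp add: matrix_vector_right_distrib vector_sadd_rdistrib)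
qed simp

lemma poly_apply_smult: "poly_apply (smult c p) A v = c *s poly_apply p A v"
proof (induction p)
  case (pCons a p)
  then show ?case
    by (simp add: vector_add_ldistrib vector_smult_assoc vector_scalar_commute)
qed simp

lemma poly_apply_monom: "poly_apply (monom c k) A v = c *s ((\<lambda>x. A *v x) ^^ k) v"
  by (induction k) (auto simp: monom_0 monom_Suc vector_scalar_commute)

lemma poly_apply_sum: "poly_apply (\<Sum>i\<in>S. p i) A v = (\<Sum>i\<in>S. poly_apply (p i) A v)"
  by (induction S rule: infinite_finite_induct) (auto simp: poly_apply_add)

lemma poly_apply_arg_diff: "poly_apply p A (v - w) = poly_apply p A v - poly_apply p A w"
proof (induction p)
  case (pCons a p)
  then show ?case
    by (simp add: vector_ssub_ldistrib matrix_vector_mult_diff_distrib)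
qed simp

lemma poly_apply_arg_smult: "poly_apply p A (c *s v) = c *s poly_apply p A v"
  by (induction p) (auto simp: vector_add_ldistrib vector_smult_assoc vector_scalar_commute mult.commute)

lemma poly_apply_commute: "poly_apply p A (A *v v) = A *v poly_apply p A v"
  by (induction p) (auto simp: vec.add vec.scale)

lemma poly_apply_linear_factor:
  "poly_apply ([:- z, 1:] * q) A v = poly_apply q A (A *v v - z *s v)"
proof -
  have "[:- z, 1:] * q = smult (- z) q + pCons 0 q" by (simp add: mult_pCons_left)
  then show ?thesis
    by (simp add: poly_apply_add poly_apply_smult poly_apply_arg_diff poly_apply_commute
        poly_apply_arg_smult del: mult_pCons_left smult_minus_left)
qed

text \<open>The vectors \<open>v, A v, A\<^sup>2 v, \<dots>\<close> lie in a finite-dimensional space, so finitely many of them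
  already satisfy a nontrivial linear relation, even one with real coefficients.\<close>

lemma annihilating_poly_exists:
  fixes A :: "complex ^ 'n ^ 'n"
  shows "\<exists>p. p \<noteq> 0 \<and> poly_apply p A v = 0"
proof -
  define f where "f i = ((\<lambda>x. A *v x) ^^ i) v" for i
  define I where "I = {..DIM(complex ^ 'n)}"
  show ?thesis
  proof (cases "inj_on f I")
    case False
    then obtain i j where ij: "i \<noteq> j" "f i = f j" by (auto simp: inj_on_def)
    have "coeff (monom 1 i + monom (- 1 :: complex) j) i \<noteq> 0" using ij by simp
    then have "monom 1 i + monom (- 1 :: complex) j \<noteq> 0" by (metis coeff_0)
    moreover have "poly_apply (monom 1 i + monom (- 1) j) A v = 0"
      using ij by (simp add: poly_apply_add poly_apply_monom f_def)
    ultimately show ?thesis by blast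
  next
    case True
    then have "card (f ` I) > DIM(complex ^ 'n)" by (simp add: card_image I_def)
    then have "dependent (f ` I)" by (intro dependent_biggerset) (auto simp: I_def)
    then obtain c y where c: "y \<in> f ` I" "c y \<noteq> 0" "(\<Sum>y\<in>f ` I. c y *\<^sub>R y) = 0"
      by (subst (asm) real_vector.dependent_finite) (auto simp: I_def)
    define p where "p = (\<Sum>i\<in>I. monom (complex_of_real (c (f i))) i)"
    have "poly_apply p A v = (\<Sum>i\<in>I. complex_of_real (c (f i)) *s f i)"
      by (simp add: p_def poly_apply_sum poly_apply_monom f_def)
    also have "\<dots> = (\<Sum>i\<in>I. c (f i) *\<^sub>R f i)"
      by (intro sum.cong) (auto simp: vec_eq_iff scaleR_conv_of_real[where 'a = complex])
    also have "\<dots> = 0"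
      using c(3) True by (simp add: sum.reindex)
    finally have "poly_apply p A v = 0" .
    moreover obtain i where i: "i \<in> I" "y = f i" using c by blast
    have "coeff p i = of_real (c (f i))"
      using i by (simp add: p_def coeff_sum I_def)
    then have "p \<noteq> 0" using c i by auto
    ultimately show ?thesis by blast
  qed
qed

text \<open>Induction on the degree of the annihilating polynomial \<open>p = (X - z) q\<close> replaces the Jordan
  normal form. The vector \<open>u = (A - z) v\<close> is annihilated by \<open>q\<close>, so its orbit tends to \<open>0\<close>, and
  \<open>A\<^sup>k\<^sup>+\<^sup>1 v = z A\<^sup>k v + A\<^sup>k u\<close> is a contractive recurrence if \<open>\<bar>z\<bar> < 1\<close>. Otherwise \<open>z\<close> is not an
  eigenvalue, so \<open>(A - z) q(A) v = 0\<close> forces \<open>q(A) v = 0\<close>.\<close>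

lemma powers_tendsto_zero_if_annihilated:
  fixes A :: "complex ^ 'n ^ 'n"
  assumes ev: "\<And>z v. v \<noteq> 0 \<Longrightarrow> A *v v = z *s v \<Longrightarrow> cmod z < 1"
  assumes "p \<noteq> 0" "poly_apply p A v = 0"
  shows "(\<lambda>k. ((\<lambda>x. A *v x) ^^ k) v) \<longlonglongrightarrow> 0"
  using assms(2,3)
proof (induction "degree p" arbitrary: p v)
  case 0
  then obtain c where "p = [:c:]" "c \<noteq> 0" by (metis degree_eq_zeroE pCons_eq_0_iff)
  then have "v = 0" using 0 by simp
  have "((\<lambda>x. A *v x) ^^ k) v = 0" for k
    using \<open>v = 0\<close> by (induction k) auto
  then show ?case by simp
next
  case (Suc d)
  then obtain z where "poly p z = 0"
    by (metis fundamental_theorem_of_algebra constant_degree nat.simps(3))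
  then obtain q where q: "p = [:- z, 1:] * q" by (metis dvdE poly_eq_0_iff_dvd)
  have q0: "q \<noteq> 0" and dq: "degree q = d"
    using q Suc by (auto simp: degree_mult_eq simp del: mult_pCons_left)
  define u where "u = A *v v - z *s v"
  have qu: "poly_apply q A u = 0"
    using Suc.prems q by (simp add: poly_apply_linear_factor u_def del: mult_pCons_left)
  show ?case
  proof (cases "cmod z < 1")
    case True
    have "(\<lambda>k. ((\<lambda>x. A *v x) ^^ k) u) \<longlonglongrightarrow> 0"
      using Suc.hyps(1)[of q u] dq q0 qu by simp
    moreover have "((\<lambda>x. A *v x) ^^ Suc k) v
        = z *s ((\<lambda>x. A *v x) ^^ k) v + ((\<lambda>x. A *v x) ^^ k) u" for k
      by (induction k) (auto simp: u_def vec.add vec.scale)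
    ultimately show ?thesis
      by (rule tendsto_zero_of_contractive_recurrence[OF _ True])
  next
    case False
    have "A *v poly_apply q A v = z *s poly_apply q A v"
      using qu by (simp add: u_def poly_apply_arg_diff poly_apply_commute poly_apply_arg_smult)
    then have "poly_apply q A v = 0" using ev False by blast
    then show ?thesis using Suc.hyps(1)[of q v] dq q0 by simp
  qed
qed

lemma matrix_powers_tendsto_zero:
  fixes A :: "real ^ 'n ^ 'n"
  assumes ev: "\<And>z v. v \<noteq> 0 \<Longrightarrow> map_matrix complex_of_real A *v v = z *s v \<Longrightarrow> cmod z < 1"
  shows "(\<lambda>k. ((\<lambda>x. A *v x) ^^ k) x) \<longlonglongrightarrow> 0"
proof -
  define c :: "real ^ 'n \<Rightarrow> complex ^ 'n" where "c y = (\<chi> i. complex_of_real (y $ i))" for y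
  define C where "C = map_matrix complex_of_real A"
  have "C *v c y = c (A *v y)" for y
    by (simp add: C_def c_def vec_eq_iff matrix_vector_mult_def map_matrix_def)
  then have pow: "((\<lambda>x. C *v x) ^^ k) (c x) = c (((\<lambda>x. A *v x) ^^ k) x)" for k
    by (induction k) auto
  obtain p where "p \<noteq> 0" "poly_apply p C (c x) = 0"
    using annihilating_poly_exists by blast
  then have "(\<lambda>k. ((\<lambda>x. C *v x) ^^ k) (c x)) \<longlonglongrightarrow> 0"
    using ev by (intro powers_tendsto_zero_if_annihilated[of C p]) (auto simp: C_def)
  then have "(\<lambda>k. c (((\<lambda>x. A *v x) ^^ k) x) $ i) \<longlonglongrightarrow> 0" for i
    unfolding pow by (metis tendsto_vec_nth zero_index)
  then have "(\<lambda>k. (((\<lambda>x. A *v x) ^^ k) x) $ i) \<longlonglongrightarrow> 0" for i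
    by (simp add: c_def flip: tendsto_of_real_iff[where 'a = complex])
  then show ?thesis by (intro vec_tendstoI) auto
qed

text \<open>A nonzero kernel vector would belong to the eigenvalue \<open>0\<close>.\<close>

lemma expansive_imp_invertible:
  fixes R :: "real ^ 'n ^ 'n"
  assumes "expansive R"
  shows "invertible R"
proof -
  have "x = 0" if "R *v x = 0" for x
  proof (rule ccontr)
    assume "x \<noteq> 0"
    define c where "c = (\<chi> i. complex_of_real (x $ i))"
    have "c \<noteq> 0" using \<open>x \<noteq> 0\<close> by (auto simp: c_def vec_eq_iff)
    moreover have "map_matrix complex_of_real R *v c = 0 *s c"
    proof -
      have "(\<Sum>j\<in>UNIV. R $ i $ j * x $ j) = 0" for i
        using that by (auto simp: vec_eq_iff matrix_vector_mult_def)
      then have "complex_of_real (\<Sum>j\<in>UNIV. R $ i $ j * x $ j) = 0" for i by simp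
      then show ?thesis
        by (simp add: c_def vec_eq_iff matrix_vector_mult_def map_matrix_def)
    qed
    ultimately have "cmod 0 > 1" using assms unfolding expansive_def by blast
    then show False by simp
  qed
  then show ?thesis
    using matrix_left_invertible_ker invertible_left_inverse by blast
qed

lemma matrix_inv_right:
  fixes A :: "real ^ 'n ^ 'n"
  assumes "invertible A"
  shows "A ** matrix_inv A = mat 1"
  using assms someI_ex[of "\<lambda>B. A ** B = mat 1 \<and> B ** A = mat 1"]
  by (auto simp: invertible_def matrix_inv_def)

text \<open>The eigenvalues of \<open>R\<^sup>-\<^sup>1\<close> are the inverses of those of \<open>R\<close>.\<close>

lemma expansive_inverse_powers_tendsto_zero:
  fixes R :: "real ^ 'n ^ 'n"
  assumes "expansive R"
  shows "(\<lambda>k. ((\<lambda>x. matrix_inv R *v x) ^^ k) x) \<longlonglongrightarrow> 0"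
proof (rule matrix_powers_tendsto_zero)
  fix z and v :: "complex ^ 'n"
  assume v: "v \<noteq> 0" and ev: "map_matrix complex_of_real (matrix_inv R) *v v = z *s v"
  let ?C = "map_matrix complex_of_real :: real ^ 'n ^ 'n \<Rightarrow> _"
  have "?C R ** ?C (matrix_inv R) = ?C (R ** matrix_inv R)"
    by (simp add: vec_eq_iff matrix_matrix_mult_def map_matrix_def)
  also have "R ** matrix_inv R = mat 1"
    using expansive_imp_invertible[OF assms] by (simp add: matrix_inv_right)
  also have "?C (mat 1) = mat 1"
    by (simp add: vec_eq_iff mat_def map_matrix_def)
  finally have "?C R *v (?C (matrix_inv R) *v v) = v"
    by (metis matrix_vector_mul_assoc matrix_vector_mul_lid)
  then have *: "z *s (?C R *v v) = v" by (simp add: ev vector_scalar_commute)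
  then have "z \<noteq> 0" using v by auto
  then have "?C R *v v = inverse z *s v"
    by (subst (2) *[symmetric]) (simp add: vector_smult_assoc)
  then have "cmod (inverse z) > 1" using assms v unfolding expansive_def by blast
  then show "cmod z < 1"
    using \<open>z \<noteq> 0\<close> by (simp add: norm_inverse one_less_inverse_iff)
qed

lemma inner_transpose_matrix_power:
  fixes A :: "real ^ 'n ^ 'n"
  shows "((\<lambda>x. transpose A *v x) ^^ k) l \<bullet> x = l \<bullet> ((\<lambda>x. A *v x) ^^ k) x"
  by (induction k arbitrary: x)
    (simp_all add: dot_lmul_matrix flip: funpow_swap1)

text \<open>Moving the transpose across the inner product gives the convergence of each coordinate and
  avoids comparing the eigenvalues of a matrix with those of its transpose.\<close>

lemma transpose_powers_tendsto_zero:
  fixes A :: "real ^ 'n ^ 'n"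
  assumes "\<And>x. (\<lambda>k. ((\<lambda>x. A *v x) ^^ k) x) \<longlonglongrightarrow> 0"
  shows "(\<lambda>k. ((\<lambda>x. transpose A *v x) ^^ k) l) \<longlonglongrightarrow> 0"
proof (rule vec_tendstoI)
  fix i
  have "(\<lambda>k. l \<bullet> ((\<lambda>x. A *v x) ^^ k) (axis i 1)) \<longlonglongrightarrow> l \<bullet> 0"
    by (intro tendsto_intros assms)
  then show "(\<lambda>k. ((\<lambda>x. transpose A *v x) ^^ k) l $ i) \<longlonglongrightarrow> 0 $ i"
    by (simp flip: inner_transpose_matrix_power add: inner_axis)
qed

lemma matrix_inv_transpose:
  fixes A :: "real ^ 'n ^ 'n"
  assumes "invertible A"
  shows "matrix_inv (transpose A) = transpose (matrix_inv A)"
proof -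
  have "transpose (matrix_inv A) ** transpose A = mat 1"
    using assms by (metis matrix_inv_right matrix_transpose_mul transpose_mat)
  moreover have "transpose A ** matrix_inv (transpose A) = mat 1"
    using assms by (intro matrix_inv_right) (simp add: transpose_invertible)
  ultimately show ?thesis
    by (metis matrix_mul_assoc matrix_mul_lid matrix_mul_rid)
qed

text \<open>Pointwise convergence on the finitely many basis vectors is uniform on bounded sets.\<close>

lemma matrix_powers_uniformly_small:
  fixes A :: "real ^ 'n ^ 'n"
  assumes lim: "\<And>x. (\<lambda>k. ((\<lambda>x. A *v x) ^^ k) x) \<longlonglongrightarrow> 0" and e: "e > 0"
  shows "\<forall>\<^sub>F k in sequentially. \<forall>x. norm x \<le> C \<longrightarrow> norm (((\<lambda>x. A *v x) ^^ k) x) < e"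
proof -
  define P where "P k x = ((\<lambda>x. A *v x) ^^ k) x" for k x
  have lin: "linear (P k)" for k
  proof (induction k)
    case (Suc k)
    have "P (Suc k) = (\<lambda>x. A *v x) \<circ> P k" by (auto simp: P_def)
    then show ?case using Suc linear_compose[of "P k"] by (metis matrix_vector_mul_linear)
  qed (simp add: P_def linear_id[unfolded id_def])
  have "(\<lambda>k. C * (\<Sum>i\<in>UNIV. norm (P k (axis i 1)))) \<longlonglongrightarrow> C * (\<Sum>i\<in>(UNIV::'n set). 0)"
    using lim by (intro tendsto_intros tendsto_norm_zero) (auto simp: P_def)
  then have "\<forall>\<^sub>F k in sequentially. C * (\<Sum>i\<in>UNIV. norm (P k (axis i 1))) < e"
    using e by (intro order_tendstoD(2)[of _ "C * (\<Sum>i\<in>(UNIV::'n set). 0)"]) auto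
  then show ?thesis
  proof eventually_elim
    case (elim k)
    have "norm (P k x) < e" if x: "norm x \<le> C" for x
    proof -
      have "P k x = P k (\<Sum>i\<in>UNIV. x $ i *\<^sub>R axis i 1)"
        using basis_expansion[of x] by (simp add: scalar_mult_eq_scaleR)
      also have "\<dots> = (\<Sum>i\<in>UNIV. x $ i *\<^sub>R P k (axis i 1))"
        using lin[of k] by (simp add: linear_sum linear_scale)
      finally have "norm (P k x) \<le> (\<Sum>i\<in>UNIV. \<bar>x $ i\<bar> * norm (P k (axis i 1)))"
        by (metis (no_types, lifting) norm_scaleR norm_sum sum.cong)
      also have "\<dots> \<le> (\<Sum>i\<in>UNIV. C * norm (P k (axis i 1)))"
        using x component_le_norm_cart[of x] by (intro sum_mono mult_right_mono) (auto intro: order_trans)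
      finally show ?thesis using elim by (simp add: sum_distrib_left)
    qed
    then show ?case by (simp add: P_def)
  qed
qed

section \<open>Indicators of closed sets as limits of Lipschitz functions\<close>

text \<open>Lipschitz functions decreasing to the indicator of a nonempty closed set. They carry invariance from
  continuous functions to Borel sets, and approximation by step functions from Lipschitz functions to
  Borel sets.\<close>

definition tent :: "'a::metric_space set \<Rightarrow> nat \<Rightarrow> 'a \<Rightarrow> real" where
  "tent C j x = max 0 (1 - real j * infdist x C)"

lemma tent_bounds: "0 \<le> tent C j x" "tent C j x \<le> 1"
  by (auto simp: tent_def infdist_nonneg)

lemma tent_lipschitz: "\<bar>tent C j x - tent C j y\<bar> \<le> real j * dist x y"
proof -
  have "\<bar>tent C j x - tent C j y\<bar> \<le> \<bar>real j * infdist x C - real j * infdist y C\<bar>"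
    by (auto simp: tent_def)
  also have "\<dots> = real j * \<bar>infdist x C - infdist y C\<bar>"
    by (metis abs_mult abs_of_nat right_diff_distrib)
  also have "\<dots> \<le> real j * dist x y"
    using infdist_triangle_abs[of x C y] by (intro mult_left_mono) auto
  finally show ?thesis .
qed

lemma continuous_on_tent [continuous_intros]: "continuous_on S (tent C j)"
  unfolding tent_def by (intro continuous_intros)

lemma tent_tendsto_indicator:
  assumes "closed C" "C \<noteq> {}"
  shows "(\<lambda>j. tent C j x) \<longlonglongrightarrow> indicator C x"
proof (cases "x \<in> C")
  case True
  then show ?thesis using assms by (simp add: tent_def)
next
  case False
  then have pos: "infdist x C > 0"
    using assms by (metis in_closed_iff_infdist_zero infdist_nonneg less_eq_real_def)
  obtain J :: nat where J: "1 / infdist x C < real J"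
    using reals_Archimedean2 by blast
  have "tent C j x = 0" if "j \<ge> J" for j
  proof -
    have "1 / infdist x C < real j" using J that by simp
    then have "1 < real j * infdist x C" using pos by (simp add: field_simps)
    then show ?thesis by (simp add: tent_def)
  qed
  then have "\<forall>\<^sub>F j in sequentially. tent C j x = 0"
    using eventually_sequentially by blast
  then show ?thesis using False by (simp add: tendsto_eventually)
qed

section \<open>Words and compositions of the maps\<close>

text \<open>Recursion on words splits off the first letter, whose map is applied first. Splitting off the last
  letter instead shows how the cells are nested.\<close>

lemma words_0 [simp]: "words B 0 = {[]}"
  by (auto simp: words_def)

lemma words_Suc: "words B (Suc n) = (\<lambda>(b, k). b # k) ` (B \<times> words B n)"
  by (force simp: words_def length_Suc_conv image_iff)

lemma finite_words: "finite B \<Longrightarrow> finite (words B n)"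
  by (induction n) (auto simp: words_Suc)

lemma card_words: "card (words B n) = card B ^ n"
proof (induction n)
  case (Suc n)
  have "inj_on (\<lambda>(b, k). b # k) (B \<times> words B n)" by (auto simp: inj_on_def)
  then show ?case by (simp add: words_Suc card_image card_cartesian_product Suc)
qed simp

lemma sum_words_Suc: "(\<Sum>k\<in>words B (Suc n). g k) = (\<Sum>b\<in>B. \<Sum>k\<in>words B n. g (b # k))"
proof -
  have "inj_on (\<lambda>(b, k). b # k) (B \<times> words B n)" by (auto simp: inj_on_def)
  then show ?thesis
    by (simp add: words_Suc sum.reindex sum.cartesian_product case_prod_unfold)
qed

lemma ifs_word_simps [simp]:
  "ifs_word R [] x = x"
  "ifs_word R (b # k) x = ifs_word R k (ifs_map R b x)"
  "ifs_word R (k @ [b]) x = ifs_map R b (ifs_word R k x)"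
  by (simp_all add: ifs_word_def)

text \<open>All maps \<open>\<tau>\<^sub>k\<close> with \<open>k\<close> of length \<open>n\<close> have the same linear part \<open>R\<^sup>-\<^sup>n\<close>.\<close>

lemma ifs_word_diff:
  "ifs_word R k x - ifs_word R k y = ((\<lambda>x. matrix_inv R *v x) ^^ length k) (x - y)"
proof (induction k arbitrary: x y)
  case (Cons b k)
  have "ifs_map R b x - ifs_map R b y = matrix_inv R *v (x - y)"
    by (simp add: ifs_map_def flip: matrix_vector_mult_diff_distrib)
  then show ?case using Cons by (simp add: funpow_swap1)
qed simp

lemma continuous_ifs_map [continuous_intros]: "continuous_on S (ifs_map R b)"
  unfolding ifs_map_def
  by (intro continuous_on_compose2[OF linear_continuous_on[of "(*v) (matrix_inv R)" UNIV]]
      continuous_intros matrix_vector_mul_bounded_linear) auto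

lemma continuous_ifs_word: "continuous_on S (ifs_word R k)"
proof (induction k rule: rev_induct)
  case (snoc b k)
  then show ?case
    using continuous_on_compose[OF snoc continuous_ifs_map] by (simp add: o_def)
qed (simp add: continuous_on_id)

lemma measurable_ifs_map [measurable]: "ifs_map R b \<in> borel_measurable borel"
  by (intro borel_measurable_continuous_onI continuous_ifs_map)

lemma measurable_ifs_word [measurable]: "ifs_word R k \<in> borel_measurable borel"
  by (intro borel_measurable_continuous_onI continuous_ifs_word)

section \<open>Invariance of the measure for integrable functions\<close>

text \<open>Expansiveness of \<open>R\<close> enters through invertibility and the decay of the powers of \<open>R\<^sup>-\<^sup>1\<close>, which
  makes the system contractive in the limit even where a single map is not a contraction for the
  Euclidean norm.\<close>

locale contractive_ifs =
  fixes R :: "real ^ 'd ^ 'd" and B X :: "(real ^ 'd) set" and \<mu> :: "(real ^ 'd) measure"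
  assumes invertible: "invertible R"
    and powers_tendsto_zero: "\<And>x. (\<lambda>k. ((\<lambda>x. matrix_inv R *v x) ^^ k) x) \<longlonglongrightarrow> 0"
    and finite_B: "finite B" and B_nonempty: "B \<noteq> {}"
    and invariant: "invariant_measure R B \<mu>"
    and attractor: "attractor R B X"
    and no_overlap: "no_overlap R B X \<mu>"
begin

sublocale prob_space \<mu>
  using invariant by (simp add: invariant_measure_def)

lemma sets_mu [measurable_cong, simp]: "sets \<mu> = sets borel"
  using invariant by (simp add: invariant_measure_def)

lemma space_mu [simp]: "space \<mu> = UNIV"
  using sets_eq_imp_space_eq[OF sets_mu] by simp

lemma card_B_pos: "card B > 0"
  using finite_B B_nonempty by (simp add: card_gt_0_iff)

lemma integrable_bounded:
  fixes h :: "real ^ 'd \<Rightarrow> 'c::{banach, second_countable_topology}"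
  assumes "h \<in> borel_measurable borel" "\<And>x. norm (h x) \<le> c"
  shows "integrable \<mu> h"
proof (rule integrable_const_bound[of _ c])
  show "h \<in> borel_measurable \<mu>" using assms by simp
qed (use assms in simp)

text \<open>Invariance holds by assumption for the continuous tent functions of \<open>C\<close>, and dominated convergence
  carries it to their limit.\<close>

lemma measure_invariant_closed:
  assumes "closed C"
  shows "real (card B) * measure \<mu> C = (\<Sum>b\<in>B. measure \<mu> (ifs_map R b -` C))"
proof (cases "C = {}")
  case False
  have lim: "(\<lambda>j. LINT x|\<mu>. tent C j (g x)) \<longlonglongrightarrow> measure \<mu> (g -` C)"
    if [measurable]: "g \<in> borel_measurable borel" for g
  proof -
    have [measurable]: "C \<in> sets borel" using assms by simp
    have [measurable]: "tent C j \<in> borel_measurable borel" for j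
      by (intro borel_measurable_continuous_onI continuous_on_tent)
    have "(\<lambda>j. LINT x|\<mu>. tent C j (g x)) \<longlonglongrightarrow> (LINT x|\<mu>. indicator C (g x))"
    proof (rule integral_dominated_convergence[where w = "\<lambda>_. 1"])
      show "AE x in \<mu>. (\<lambda>j. tent C j (g x)) \<longlonglongrightarrow> indicator C (g x)"
        using tent_tendsto_indicator[OF assms False] by simp
      show "AE x in \<mu>. norm (tent C j (g x)) \<le> 1" for j
        using tent_bounds[of C j] by simp
    qed simp_all
    also have "(LINT x|\<mu>. indicator C (g x)) = (LINT x|\<mu>. indicator (g -` C) x :: real)"
      by (intro Bochner_Integration.integral_cong) (auto simp: indicator_def)
    also have "\<dots> = measure \<mu> (g -` C)" by simp
    finally show ?thesis .
  qed
  have eq: "real (card B) * (LINT x|\<mu>. tent C j x) = (\<Sum>b\<in>B. LINT x|\<mu>. tent C j (ifs_map R b x))" for j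
    using invariant continuous_on_tent[of UNIV C j] card_B_pos
    by (simp add: invariant_measure_def)
  have "(\<lambda>j. \<Sum>b\<in>B. LINT x|\<mu>. tent C j (ifs_map R b x)) \<longlonglongrightarrow> (\<Sum>b\<in>B. measure \<mu> (ifs_map R b -` C))"
    by (intro tendsto_sum lim) simp
  moreover have "(\<lambda>j. real (card B) * (LINT x|\<mu>. tent C j x)) \<longlonglongrightarrow> real (card B) * measure \<mu> C"
    using lim[of "\<lambda>x. x"] by (intro tendsto_mult_left) simp
  ultimately show ?thesis unfolding eq by (rule LIMSEQ_unique[symmetric])
qed simp

text \<open>The closed sets form an intersection-stable generator of the Borel sets.\<close>

lemma measure_invariant:
  assumes "E \<in> sets borel"
  shows "real (card B) * measure \<mu> E = (\<Sum>b\<in>B. measure \<mu> (ifs_map R b -` E))"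
proof -
  have sets: "sets borel = sigma_sets UNIV (Collect closed :: (real ^ 'd) set set)"
    by (simp add: borel_eq_closed)
  have pre: "ifs_map R b -` S \<in> sets borel" if "S \<in> sets borel" for b S
    using measurable_sets[OF measurable_ifs_map that] by simp
  have "Int_stable (Collect closed :: (real ^ 'd) set set)"
    by (auto simp: Int_stable_def)
  moreover have "Collect closed \<subseteq> Pow (UNIV :: (real ^ 'd) set)" by simp
  ultimately show ?thesis
    using assms unfolding sets
  proof (induction rule: sigma_sets_induct_disjoint)
    case (basic C)
    then show ?case by (simp add: measure_invariant_closed)
  next
    case empty
    show ?case by simp
  next
    case (compl S)
    then have S: "S \<in> sets borel" by (simp add: sets)
    have "measure \<mu> (ifs_map R b -` (UNIV - S)) = 1 - measure \<mu> (ifs_map R b -` S)" for b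
      using prob_compl[of "ifs_map R b -` S"] pre[OF S] by (simp add: vimage_Diff)
    moreover have "measure \<mu> (UNIV - S) = 1 - measure \<mu> S"
      using prob_compl[of S] S by simp
    ultimately show ?case
      using compl by (simp add: sum_subtractf right_diff_distrib)
  next
    case (union S)
    have S: "range S \<subseteq> sets borel" using union by (simp add: sets)
    have "(\<lambda>i. real (card B) * measure \<mu> (S i)) sums (real (card B) * measure \<mu> (\<Union>i. S i))"
      using union(1) S by (intro sums_mult finite_measure_UNION) auto
    moreover have "(\<lambda>i. \<Sum>b\<in>B. measure \<mu> (ifs_map R b -` S i)) sums
        (\<Sum>b\<in>B. measure \<mu> (\<Union>i. ifs_map R b -` S i))"
      using union(1) S pre
      by (intro sums_sum finite_measure_UNION) (auto simp: disjoint_family_on_def)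
    ultimately show ?case
      using union(3) by (simp add: vimage_UN sums_iff)
  qed
qed

text \<open>Invariance exhibits \<open>card B\<close> times \<open>\<mu>\<close> as a sum of image measures, so it dominates each of them.
  This yields integrability along the maps, and later that almost-everywhere statements can be pulled
  back.\<close>

lemma nn_integral_ifs_map_le:
  assumes "b \<in> B" and [measurable]: "h \<in> borel_measurable borel"
  shows "(\<integral>\<^sup>+x. h (ifs_map R b x) \<partial>\<mu>) \<le> of_nat (card B) * (\<integral>\<^sup>+x. h x \<partial>\<mu>)"
proof -
  have "distr \<mu> borel (ifs_map R b) \<le> scale_measure (of_nat (card B)) \<mu>"
  proof (subst le_measure; clarsimp)
    fix E :: "(real ^ 'd) set" assume E [measurable]: "E \<in> sets borel"
    have "measure \<mu> (ifs_map R b -` E) \<le> (\<Sum>b\<in>B. measure \<mu> (ifs_map R b -` E))"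
      using assms finite_B by (intro member_le_sum) auto
    also have "\<dots> = real (card B) * measure \<mu> E"
      using measure_invariant[OF E] by simp
    finally have "ennreal (measure \<mu> (ifs_map R b -` E)) \<le> of_nat (card B) * ennreal (measure \<mu> E)"
      by (metis ennreal_leI ennreal_mult ennreal_of_nat_eq_real_of_nat measure_nonneg of_nat_0_le_iff)
    then show "emeasure (distr \<mu> borel (ifs_map R b)) E \<le> of_nat (card B) * emeasure \<mu> E"
      by (simp add: emeasure_distr emeasure_eq_measure)
  qed
  then have "(\<integral>\<^sup>+x. h x \<partial>distr \<mu> borel (ifs_map R b)) \<le> (\<integral>\<^sup>+x. h x \<partial>scale_measure (of_nat (card B)) \<mu>)"
    by (intro nn_integral_mono_measure) auto
  then show ?thesis by (simp add: nn_integral_distr nn_integral_scale_measure)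
qed

lemma integrable_ifs_map:
  fixes h :: "real ^ 'd \<Rightarrow> 'c::{banach, second_countable_topology}"
  assumes h: "integrable \<mu> h" and b: "b \<in> B"
  shows "integrable \<mu> (\<lambda>x. h (ifs_map R b x))"
proof (rule integrableI_bounded)
  have [measurable]: "h \<in> borel_measurable borel" using borel_measurable_integrable[OF h] by simp
  show "(\<lambda>x. h (ifs_map R b x)) \<in> borel_measurable \<mu>" by measurable
  have "(\<integral>\<^sup>+x. norm (h (ifs_map R b x)) \<partial>\<mu>) \<le> of_nat (card B) * (\<integral>\<^sup>+x. norm (h x) \<partial>\<mu>)"
    by (rule nn_integral_ifs_map_le[OF b, where h = "\<lambda>x. ennreal (norm (h x))"]) measurable
  also have "\<dots> < \<infinity>"
    using h by (simp add: integrable_iff_bounded ennreal_mult_less_top of_nat_less_top)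
  finally show "(\<integral>\<^sup>+x. norm (h (ifs_map R b x)) \<partial>\<mu>) < \<infinity>" .
qed

lemma integral_invariant:
  fixes h :: "real ^ 'd \<Rightarrow> 'c::{banach, second_countable_topology}"
  assumes h: "integrable \<mu> h"
  shows "real (card B) *\<^sub>R (LINT x|\<mu>. h x) = (\<Sum>b\<in>B. LINT x|\<mu>. h (ifs_map R b x))"
  using h
proof (induction rule: integrable_induct)
  case (base E c)
  have E: "E \<in> sets borel" using base by simp
  have "(LINT x|\<mu>. indicator E (ifs_map R b x) *\<^sub>R c) = measure \<mu> (ifs_map R b -` E) *\<^sub>R c" for b
  proof -
    have "ifs_map R b -` E \<in> sets borel" using measurable_sets[OF measurable_ifs_map E] by simp
    moreover have "(LINT x|\<mu>. indicator E (ifs_map R b x) *\<^sub>R c) = (LINT x|\<mu>. indicator (ifs_map R b -` E) x *\<^sub>R c)"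
      by (intro Bochner_Integration.integral_cong) (auto simp: indicator_def)
    ultimately show ?thesis
      by (simp add: integral_scaleR_left less_top[symmetric])
  qed
  then show ?case
    using E measure_invariant[OF E]
    by (simp add: integral_scaleR_left less_top[symmetric] flip: scaleR_left.sum)
next
  case (add f g)
  then show ?case
    by (simp add: integrable_ifs_map scaleR_add_right sum.distrib)
next
  case (lim f s)
  have lims: "(\<lambda>i. LINT x|\<mu>. s i (g x)) \<longlonglongrightarrow> (LINT x|\<mu>. f (g x))"
    if [measurable]: "g \<in> borel_measurable borel" and int: "integrable \<mu> (\<lambda>x. f (g x))" for g
  proof (rule integral_dominated_convergence[where w = "\<lambda>x. 2 * norm (f (g x))"])
    have [measurable]: "s i \<in> borel_measurable borel" for i
      using borel_measurable_integrable[OF lim.hyps(1)] by simp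
    show "(\<lambda>x. s i (g x)) \<in> borel_measurable \<mu>" for i by measurable
    show "AE x in \<mu>. (\<lambda>i. s i (g x)) \<longlonglongrightarrow> f (g x)" using lim.hyps(2) by simp
    show "AE x in \<mu>. norm (s i (g x)) \<le> 2 * norm (f (g x))" for i using lim.hyps(3) by simp
    show "integrable \<mu> (\<lambda>x. 2 * norm (f (g x)))" using int by simp
    show "(\<lambda>x. f (g x)) \<in> borel_measurable \<mu>" using int by simp
  qed
  have "(\<lambda>i. \<Sum>b\<in>B. LINT x|\<mu>. s i (ifs_map R b x)) \<longlonglongrightarrow> (\<Sum>b\<in>B. LINT x|\<mu>. f (ifs_map R b x))"
    by (intro tendsto_sum lims integrable_ifs_map lim.hyps) auto
  moreover have "(\<lambda>i. real (card B) *\<^sub>R (LINT x|\<mu>. s i x)) \<longlonglongrightarrow> real (card B) *\<^sub>R (LINT x|\<mu>. f x)"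
    using lims[of "\<lambda>x. x"] lim.hyps(4) by (intro tendsto_scaleR tendsto_const) simp
  ultimately show ?case using lim.IH by (metis (no_types, lifting) LIMSEQ_unique ext)
qed

lemma integrable_ifs_word:
  fixes h :: "real ^ 'd \<Rightarrow> 'c::{banach, second_countable_topology}"
  assumes "integrable \<mu> h" and "set k \<subseteq> B"
  shows "integrable \<mu> (\<lambda>x. h (ifs_word R k x))"
  using assms(2)
proof (induction k)
  case (Cons b k)
  then show ?case using integrable_ifs_map[of "\<lambda>x. h (ifs_word R k x)" b] by simp
qed (use assms in simp)

lemma integral_invariant_words:
  fixes h :: "real ^ 'd \<Rightarrow> 'c::{banach, second_countable_topology}"
  assumes h: "integrable \<mu> h"
  shows "(real (card B) ^ n) *\<^sub>R (LINT x|\<mu>. h x) = (\<Sum>k\<in>words B n. LINT x|\<mu>. h (ifs_word R k x))"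
proof (induction n)
  case (Suc n)
  have "(real (card B) ^ Suc n) *\<^sub>R (LINT x|\<mu>. h x)
      = (\<Sum>k\<in>words B n. real (card B) *\<^sub>R (LINT x|\<mu>. h (ifs_word R k x)))"
    by (simp add: Suc flip: scaleR_scaleR scaleR_right.sum)
  also have "\<dots> = (\<Sum>k\<in>words B n. \<Sum>b\<in>B. LINT x|\<mu>. h (ifs_word R (b # k) x))"
    using integral_invariant[OF integrable_ifs_word[OF h]]
    by (intro sum.cong) (auto simp: words_def)
  finally show ?case by (simp add: sum_words_Suc sum.swap[of _ _ B])
qed simp

text \<open>The image of \<open>\<mu>\<close> under \<open>\<tau>\<^sub>k\<close> is absolutely continuous with respect to \<open>\<mu>\<close>.\<close>

lemma AE_ifs_word:
  assumes "AE x in \<mu>. P x" and "set k \<subseteq> B"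
  shows "AE x in \<mu>. P (ifs_word R k x)"
  using assms(2)
proof (induction k)
  case (Cons b k)
  then obtain E where E: "{x. \<not> P (ifs_word R k x)} \<subseteq> E" "emeasure \<mu> E = 0" "E \<in> sets borel"
    by (force elim!: AE_E)
  have "(\<integral>\<^sup>+x. indicator E (ifs_map R b x) \<partial>\<mu>) \<le> of_nat (card B) * (\<integral>\<^sup>+x. indicator E x \<partial>\<mu>)"
    using Cons E by (intro nn_integral_ifs_map_le) auto
  then have "(\<integral>\<^sup>+x. indicator E (ifs_map R b x) \<partial>\<mu>) = 0" using E by simp
  then have "AE x in \<mu>. indicator E (ifs_map R b x) = (0 :: ennreal)"
    using E by (subst (asm) nn_integral_0_iff_AE) auto
  then show ?case
  proof eventually_elim
    case (elim x)
    then show ?case using E by (auto simp: indicator_def split: if_splits)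
  qed
qed (use assms in simp)

section \<open>The cells of the attractor\<close>

lemma inj_ifs_map: "inj (ifs_map R b)"
proof (rule injI)
  fix x y assume "ifs_map R b x = ifs_map R b y"
  then have "R *v (matrix_inv R *v (x + b)) = R *v (matrix_inv R *v (y + b))" by (simp add: ifs_map_def)
  then show "x = y"
    using matrix_inv_right[OF invertible] by (simp add: matrix_vector_mul_assoc)
qed

lemma closed_X: "closed X" and X_nonempty: "X \<noteq> {}" and compact_X: "compact X"
  and ifs_map_X: "b \<in> B \<Longrightarrow> ifs_map R b ` X \<subseteq> X"
  using attractor by (auto simp: attractor_def compact_imp_closed)

lemma ifs_word_X: "set k \<subseteq> B \<Longrightarrow> ifs_word R k ` X \<subseteq> X"
proof (induction k rule: rev_induct)
  case (snoc b k)
  then show ?case using ifs_map_X[of b] by fastforce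
qed simp

lemma sets_ifs_word_X [measurable]: "ifs_word R k ` X \<in> sets borel"
  by (intro borel_closed compact_imp_closed compact_continuous_image continuous_ifs_word compact_X)

text \<open>The differences of points of a cell are the vectors \<open>R\<^sup>-\<^sup>n (x - y)\<close> with \<open>x\<close> and \<open>y\<close> in the bounded
  set \<open>X\<close>.\<close>

lemma eventually_cells_small:
  assumes "e > 0"
  shows "\<forall>\<^sub>F n in sequentially. \<forall>k\<in>words B n. \<forall>x\<in>X. \<forall>y\<in>X. dist (ifs_word R k x) (ifs_word R k y) < e"
  using matrix_powers_uniformly_small[OF powers_tendsto_zero assms, of "diameter X"]
proof eventually_elim
  case (elim n)
  show ?case
  proof (intro ballI)
    fix k x y assume "k \<in> words B n" "x \<in> X" "y \<in> X"
    moreover then have "norm (x - y) \<le> diameter X"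
      using diameter_bounded_bound[OF compact_imp_bounded[OF compact_X]] by (simp add: dist_norm)
    ultimately show "dist (ifs_word R k x) (ifs_word R k y) < e"
      using elim by (simp add: dist_norm ifs_word_diff words_def)
  qed
qed

text \<open>Iterating invariance for the truncated distance to \<open>X\<close>: the point \<open>\<tau>\<^sub>k(x)\<close> has distance at most
  \<open>\<bar>R\<^sup>-\<^sup>n (x - x\<^sub>0)\<bar>\<close> from \<open>\<tau>\<^sub>k(x\<^sub>0)\<close>, which lies in \<open>X\<close> when \<open>x\<^sub>0\<close> does, and this bound is the same for
  all words and tends to \<open>0\<close>. Hence the mean distance to \<open>X\<close> is \<open>0\<close>.\<close>

lemma AE_in_X: "AE x in \<mu>. x \<in> X"
proof -
  define f where "f x = min 1 (infdist x X)" for x :: "real ^ 'd"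
  obtain x0 where x0: "x0 \<in> X" using X_nonempty by blast
  define g where "g n x = min 1 (norm (((\<lambda>x. matrix_inv R *v x) ^^ n) (x - x0)))" for n x
  have cont: "continuous_on UNIV (\<lambda>x. ((\<lambda>x. matrix_inv R *v x) ^^ n) (x - x0))" for n
  proof (induction n)
    case (Suc n)
    have "continuous_on UNIV (\<lambda>y. matrix_inv R *v y)"
      by (intro linear_continuous_on matrix_vector_mul_bounded_linear)
    from continuous_on_compose2[OF this Suc] show ?case by simp
  qed (auto intro!: continuous_intros)
  have [measurable]: "f \<in> borel_measurable borel"
    unfolding f_def by (intro borel_measurable_continuous_onI continuous_intros)
  have [measurable]: "g n \<in> borel_measurable borel" for n
    unfolding g_def by (intro borel_measurable_continuous_onI continuous_intros cont)
  have f: "0 \<le> f x" "f x \<le> 1" and g: "0 \<le> g n x" "g n x \<le> 1" for x n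
    by (auto simp: f_def g_def infdist_nonneg)
  have int: "integrable \<mu> f" "integrable \<mu> (g n)" for n
    using f g by (auto intro!: integrable_bounded[of _ 1])
  have le: "(LINT x|\<mu>. f x) \<le> (LINT x|\<mu>. g n x)" for n
  proof -
    have "f (ifs_word R k x) \<le> g n x" if k: "k \<in> words B n" for k x
    proof -
      have "ifs_word R k x0 \<in> X" using ifs_word_X[of k] k x0 by (auto simp: words_def)
      then have "infdist (ifs_word R k x) X \<le> dist (ifs_word R k x) (ifs_word R k x0)"
        by (rule infdist_le)
      then show ?thesis
        using k by (auto simp: f_def g_def dist_norm ifs_word_diff words_def)
    qed
    then have "(\<Sum>k\<in>words B n. LINT x|\<mu>. f (ifs_word R k x)) \<le> (\<Sum>k\<in>words B n. LINT x|\<mu>. g n x)"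
      using int by (intro sum_mono integral_mono integrable_ifs_word) (auto simp: words_def)
    then have "real (card B) ^ n * (LINT x|\<mu>. f x) \<le> real (card B) ^ n * (LINT x|\<mu>. g n x)"
      using integral_invariant_words[OF int(1), of n] by (simp add: card_words)
    then show ?thesis using card_B_pos by simp
  qed
  have "(\<lambda>n. LINT x|\<mu>. g n x) \<longlonglongrightarrow> (LINT x|\<mu>. 0)"
  proof (rule integral_dominated_convergence[where w = "\<lambda>_. 1"])
    have "(\<lambda>n. g n x) \<longlonglongrightarrow> min 1 (norm (0 :: real ^ 'd))" for x
      unfolding g_def by (intro tendsto_intros powers_tendsto_zero)
    then show "AE x in \<mu>. (\<lambda>n. g n x) \<longlonglongrightarrow> 0" by simp
  qed (use g in \<open>simp_all\<close>)
  then have "(LINT x|\<mu>. f x) \<le> 0"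
    using le by (intro LIMSEQ_le_const[of _ 0]) auto
  then have "(LINT x|\<mu>. f x) = 0" using f by (simp add: antisym)
  then have "AE x in \<mu>. f x = 0"
    using integral_nonneg_eq_0_iff_AE[OF int(1)] f by simp
  then show ?thesis
  proof eventually_elim
    case (elim x)
    then have "infdist x X = 0" by (simp add: f_def min_def split: if_splits)
    then show ?case using in_closed_iff_infdist_zero[OF closed_X X_nonempty] by simp
  qed
qed

text \<open>The absence of overlap says that almost no point lies in both first-level cells. Pulled back along
  the map of \<open>b'\<close>, and because \<open>\<mu>\<close> lives on \<open>X\<close>, this is a statement about images of points. In this
  form it can be iterated.\<close>

lemma AE_ifs_map_notin:
  assumes "b \<in> B" "b' \<in> B" "b \<noteq> b'"
  shows "AE x in \<mu>. ifs_map R b' x \<notin> ifs_map R b ` X"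
proof -
  have [measurable]: "ifs_map R c ` X \<in> sets borel" for c
    using sets_ifs_word_X[of "[c]"] by simp
  have "AE x in \<mu>. x \<notin> ifs_map R b ` X \<inter> ifs_map R b' ` X"
    using no_overlap assms unfolding no_overlap_def
    by (intro AE_not_in) (auto simp: null_sets_def emeasure_eq_measure)
  then have "AE x in \<mu>. ifs_map R b' x \<notin> ifs_map R b ` X \<inter> ifs_map R b' ` X"
    using AE_ifs_word[of _ "[b']"] assms by simp
  then show ?thesis
    using AE_in_X by eventually_elim auto
qed

text \<open>Compare the last letters, which determine the first-level cells. If they differ, the case of
  single letters applies; if they agree, the last map is injective and can be cancelled.\<close>

lemma AE_ifs_word_notin:
  assumes "k \<in> words B n" "k' \<in> words B n" "k \<noteq> k'"
  shows "AE x in \<mu>. ifs_word R k' x \<notin> ifs_word R k ` X"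
  using assms
proof (induction n arbitrary: k k')
  case (Suc n)
  obtain b j where k: "k = j @ [b]" "j \<in> words B n" "b \<in> B"
    using Suc.prems(1) by (cases k rule: rev_cases) (auto simp: words_def)
  obtain b' j' where k': "k' = j' @ [b']" "j' \<in> words B n" "b' \<in> B"
    using Suc.prems(2) by (cases k' rule: rev_cases) (auto simp: words_def)
  show ?case
  proof (cases "b = b'")
    case True
    then have "AE x in \<mu>. ifs_word R j' x \<notin> ifs_word R j ` X"
      using Suc k k' by auto
    then show ?thesis
    proof eventually_elim
      case (elim x)
      then show ?case using True k k' inj_ifs_map[of b'] by (auto dest: injD)
    qed
  next
    case False
    have "AE x in \<mu>. ifs_map R b' (ifs_word R j' x) \<notin> ifs_map R b ` X"
      using AE_ifs_word[OF AE_ifs_map_notin, of b b' j'] False k k' by (auto simp: words_def)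
    then show ?thesis
    proof eventually_elim
      case (elim x)
      then show ?case using k k' ifs_word_X[of j] by (auto simp: words_def)
    qed
  qed
qed simp

section \<open>Step functions and their Fourier coefficients\<close>

definition step :: "nat \<Rightarrow> ((real ^ 'd) list \<Rightarrow> complex) \<Rightarrow> real ^ 'd \<Rightarrow> complex" where
  "step n f x = (\<Sum>k\<in>words B n. f k * indicator (ifs_word R k ` X) x)"

lemma measurable_step [measurable]: "step n f \<in> borel_measurable borel"
  unfolding step_def by measurable

lemma norm_step_le: "norm (step n f x) \<le> (\<Sum>k\<in>words B n. norm (f k))"
  unfolding step_def
  by (intro sum_norm_le) (auto simp: norm_mult indicator_def)

text \<open>Almost every \<open>x\<close> lies in \<open>X\<close>, so \<open>\<tau>\<^sub>k(x)\<close> lies in its own cell, and it lies in no other cell because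
  there is no overlap.\<close>

lemma AE_step:
  assumes k: "k \<in> words B n"
  shows "AE x in \<mu>. step n f (ifs_word R k x) = f k"
proof -
  have "AE x in \<mu>. \<forall>j\<in>words B n - {k}. ifs_word R k x \<notin> ifs_word R j ` X"
    using k finite_words[OF finite_B]
    by (intro AE_finite_allI) (auto intro: AE_ifs_word_notin)
  then show ?thesis
    using AE_in_X
  proof eventually_elim
    case (elim x)
    have "step n f (ifs_word R k x) = (\<Sum>j\<in>words B n. if j = k then f k else 0)"
      unfolding step_def using elim by (intro sum.cong) auto
    then show ?case using k finite_words[OF finite_B] by simp
  qed
qed

text \<open>Iterated invariance at level \<open>n\<close> turns an integral over \<open>X\<close> into integrals over the cells, where the
  step function is constant. The three uses are its norm, its Fourier coefficients and its distance
  to a given function.\<close>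

lemma integral_step_words:
  fixes \<phi> :: "complex \<Rightarrow> real ^ 'd \<Rightarrow> 'c::{banach, second_countable_topology}"
  assumes int: "integrable \<mu> (\<lambda>x. \<phi> (step n f x) x)"
    and meas: "\<And>k. k \<in> words B n \<Longrightarrow> \<phi> (f k) \<in> borel_measurable borel"
  shows "(real (card B) ^ n) *\<^sub>R (LINT x|\<mu>. \<phi> (step n f x) x)
    = (\<Sum>k\<in>words B n. LINT x|\<mu>. \<phi> (f k) (ifs_word R k x))"
proof -
  have "(LINT x|\<mu>. \<phi> (step n f (ifs_word R k x)) (ifs_word R k x)) = (LINT x|\<mu>. \<phi> (f k) (ifs_word R k x))"
    if k: "k \<in> words B n" for k
  proof (rule integral_cong_AE)
    have [measurable]: "\<phi> (f k) \<in> borel_measurable borel" using meas k by simp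
    show "(\<lambda>x. \<phi> (step n f (ifs_word R k x)) (ifs_word R k x)) \<in> borel_measurable \<mu>"
      using integrable_ifs_word[OF int, of k] k
      by (intro borel_measurable_integrable) (auto simp: words_def)
    show "(\<lambda>x. \<phi> (f k) (ifs_word R k x)) \<in> borel_measurable \<mu>" by measurable
    show "AE x in \<mu>. \<phi> (step n f (ifs_word R k x)) (ifs_word R k x) = \<phi> (f k) (ifs_word R k x)"
      using AE_step[OF k, of f] by eventually_elim simp
  qed
  then show ?thesis
    using integral_invariant_words[OF int, of n] by simp
qed

lemma square_integrable_bounded:
  assumes [measurable]: "v \<in> borel_measurable borel" and "\<And>x. norm (v x) \<le> c"
  shows "square_integrable \<mu> v"
proof -
  have "(cmod (v x))\<^sup>2 \<le> c\<^sup>2" for x using assms by (intro power_mono) auto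
  then show ?thesis
    unfolding square_integrable_def by (auto intro!: integrable_bounded[of _ "c\<^sup>2"])
qed

lemma square_integrable_step: "square_integrable \<mu> (step n f)"
  by (rule square_integrable_bounded[OF measurable_step norm_step_le])

lemma L2_norm_sq_step: "real (card B) ^ n * L2_norm_sq \<mu> (step n f) = word_norm_sq B n f"
  using integral_step_words[of "\<lambda>c x. (cmod c)\<^sup>2" n f] square_integrable_step[of n f]
  by (simp add: square_integrable_def L2_norm_sq_def word_norm_sq_def prob_space[unfolded space_mu])

lemma norm_expo [simp]: "cmod (expo l x) = 1"
  by (simp add: expo_def norm_exp_eq_Re)

lemma measurable_expo [measurable]: "expo l \<in> borel_measurable borel"
  unfolding expo_def
  by (intro borel_measurable_continuous_onI continuous_intros)

lemma measurable_cnj_expo [measurable]: "(\<lambda>x. cnj (expo l x)) \<in> borel_measurable borel"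
  unfolding expo_def
  by (intro borel_measurable_continuous_onI continuous_intros)

lemma expo_ifs_word:
  assumes "length k = n"
  shows "expo l (ifs_word R k x)
    = expo l (ifs_word R k 0) * expo (((\<lambda>x. matrix_inv (transpose R) *v x) ^^ n) l) x"
proof -
  have "ifs_word R k x = ifs_word R k 0 + ((\<lambda>x. matrix_inv R *v x) ^^ n) x"
    using ifs_word_diff[of R k x 0] assms by (simp add: algebra_simps)
  then have "l \<bullet> ifs_word R k x = l \<bullet> ifs_word R k 0 + ((\<lambda>x. matrix_inv (transpose R) *v x) ^^ n) l \<bullet> x"
    by (simp add: inner_right_distrib inner_transpose_matrix_power matrix_inv_transpose[OF invertible]
        del: transpose_matrix_vector)
  then show ?thesis by (simp add: expo_def ring_distribs exp_add)
qed

text \<open>On the cell of \<open>k\<close> the exponential is its value at \<open>\<tau>\<^sub>k(0)\<close>, which up to normalization is the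
  matrix entry for \<open>k\<close>, times an exponential with the frequency \<open>(R\<^sup>T)\<^sup>-\<^sup>n l\<close>, which is the same for all
  cells of level \<open>n\<close>. Hence the Fourier transform of \<open>\<mu>\<close> splits off as a common factor.\<close>

lemma L2_inner_step:
  "(cmod (L2_inner \<mu> (step n f) (expo l)))\<^sup>2 = (cmod (A_apply R B n f l))\<^sup>2
    * (cmod (fourier_transform \<mu> (((\<lambda>x. matrix_inv (transpose R) *v x) ^^ n) l)))\<^sup>2 / real (card B) ^ n"
proof -
  define l' where "l' = ((\<lambda>x. matrix_inv (transpose R) *v x) ^^ n) l"
  define K where "K = real (card B) ^ n"
  have K: "K > 0" using card_B_pos by (simp add: K_def)
  have int: "integrable \<mu> (\<lambda>x. step n f x * cnj (expo l x))"
    by (rule integrable_bounded[where c = "\<Sum>k\<in>words B n. norm (f k)"])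
      (use norm_step_le in \<open>simp_all add: norm_mult\<close>)
  have entry: "A_entry R B n l k = cnj (expo l (ifs_word R k 0)) / sqrt K" for k
    by (simp add: A_entry_def expo_def exp_cnj K_def)
  have "K * L2_inner \<mu> (step n f) (expo l)
      = (\<Sum>k\<in>words B n. LINT x|\<mu>. f k * cnj (expo l (ifs_word R k x)))"
    using integral_step_words[of "\<lambda>c x. c * cnj (expo l x)" n f] int
    by (simp add: L2_inner_def K_def scaleR_conv_of_real)
  also have "\<dots> = (\<Sum>k\<in>words B n. (sqrt K * A_entry R B n l k * f k) * cnj (fourier_transform \<mu> l'))"
  proof (rule sum.cong)
    fix k assume "k \<in> words B n"
    then have len: "length k = n" by (simp add: words_def)
    have "(LINT x|\<mu>. f k * cnj (expo l (ifs_word R k x)))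
        = (LINT x|\<mu>. (f k * cnj (expo l (ifs_word R k 0))) * cnj (expo l' x))"
    proof (rule Bochner_Integration.integral_cong[OF refl])
      fix x
      show "f k * cnj (expo l (ifs_word R k x)) = (f k * cnj (expo l (ifs_word R k 0))) * cnj (expo l' x)"
        unfolding expo_ifs_word[OF len, of l x] l'_def by (simp add: mult.assoc)
    qed
    also have "\<dots> = f k * cnj (expo l (ifs_word R k 0)) * (LINT x|\<mu>. cnj (expo l' x))"
      by (rule integral_mult_right_zero)
    also have "(LINT x|\<mu>. cnj (expo l' x)) = cnj (fourier_transform \<mu> l')"
      unfolding fourier_transform_def expo_def by (rule Bochner_Integration.integral_cnj)
    also have "cnj (expo l (ifs_word R k 0)) = sqrt K * A_entry R B n l k"
      using K by (simp add: entry)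
    finally show "(LINT x|\<mu>. f k * cnj (expo l (ifs_word R k x)))
        = (sqrt K * A_entry R B n l k * f k) * cnj (fourier_transform \<mu> l')"
      by (simp add: mult_ac)
  qed simp
  also have "\<dots> = sqrt K * A_apply R B n f l * cnj (fourier_transform \<mu> l')"
    by (simp add: A_apply_def sum_distrib_left sum_distrib_right mult.assoc)
  finally have "K * cmod (L2_inner \<mu> (step n f) (expo l))
      = sqrt K * cmod (A_apply R B n f l) * cmod (fourier_transform \<mu> l')"
    using K by (metis (no_types, lifting) abs_of_pos complex_mod_cnj norm_mult norm_of_real real_sqrt_gt_zero)
  then have "K\<^sup>2 * (cmod (L2_inner \<mu> (step n f) (expo l)))\<^sup>2
      = K * ((cmod (A_apply R B n f l))\<^sup>2 * (cmod (fourier_transform \<mu> l'))\<^sup>2)"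
    using K by (metis mult.assoc less_imp_le power_mult_distrib real_sqrt_pow2)
  then show ?thesis
    using K by (simp add: power2_eq_square field_simps flip: K_def l'_def)
qed

end

section \<open>Density of the step functions in the square-integrable functions\<close>

lemma norm_add_sq_le:
  fixes a b :: "'a::real_normed_vector"
  shows "(norm (a + b))\<^sup>2 \<le> 2 * (norm a)\<^sup>2 + 2 * (norm b)\<^sup>2"
proof -
  have "(norm (a + b))\<^sup>2 \<le> (norm a + norm b)\<^sup>2"
    by (intro power_mono norm_triangle_ineq) auto
  also have "\<dots> \<le> 2 * (norm a)\<^sup>2 + 2 * (norm b)\<^sup>2"
    using sum_squares_bound[of "norm a" "norm b"] by (simp add: power2_sum)
  finally show ?thesis .
qed

lemma square_integrable_add:
  assumes v: "square_integrable M v" and w: "square_integrable M w"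
  shows "square_integrable M (\<lambda>x. v x + w x)"
    and "L2_norm_sq M (\<lambda>x. v x + w x) \<le> 2 * L2_norm_sq M v + 2 * L2_norm_sq M w"
proof -
  have [measurable]: "v \<in> borel_measurable M" "w \<in> borel_measurable M"
    using v w by (auto simp: square_integrable_def)
  have int: "integrable M (\<lambda>x. (cmod (v x))\<^sup>2)" "integrable M (\<lambda>x. (cmod (w x))\<^sup>2)"
    using v w by (auto simp: square_integrable_def)
  have dom: "integrable M (\<lambda>x. 2 * (cmod (v x))\<^sup>2 + 2 * (cmod (w x))\<^sup>2)"
    using int by simp
  have int_add: "integrable M (\<lambda>x. (cmod (v x + w x))\<^sup>2)"
    by (rule Bochner_Integration.integrable_bound[OF dom]) (use norm_add_sq_le[of "v _" "w _"] in auto)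
  then show "square_integrable M (\<lambda>x. v x + w x)" by (simp add: square_integrable_def)
  have "L2_norm_sq M (\<lambda>x. v x + w x) \<le> (LINT x|M. 2 * (cmod (v x))\<^sup>2 + 2 * (cmod (w x))\<^sup>2)"
    unfolding L2_norm_sq_def by (intro integral_mono int_add dom norm_add_sq_le)
  then show "L2_norm_sq M (\<lambda>x. v x + w x) \<le> 2 * L2_norm_sq M v + 2 * L2_norm_sq M w"
    using int by (simp add: L2_norm_sq_def)
qed

lemma square_integrable_cmult:
  assumes "square_integrable M v"
  shows "square_integrable M (\<lambda>x. c * v x)"
    and "L2_norm_sq M (\<lambda>x. c * v x) = (cmod c)\<^sup>2 * L2_norm_sq M v"
  using assms by (auto simp: square_integrable_def L2_norm_sq_def norm_mult power_mult_distrib)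

lemma square_integrable_diff:
  assumes "square_integrable M v" and "square_integrable M w"
  shows "square_integrable M (\<lambda>x. v x - w x)"
  using square_integrable_add(1)[OF assms(1) square_integrable_cmult(1)[OF assms(2), of "-1"]] by simp

lemma L2_norm_sq_triangle:
  assumes "square_integrable M u" and "square_integrable M v" and "square_integrable M w"
  shows "L2_norm_sq M (\<lambda>x. u x - w x)
    \<le> 2 * L2_norm_sq M (\<lambda>x. u x - v x) + 2 * L2_norm_sq M (\<lambda>x. v x - w x)"
  using square_integrable_add(2)[OF square_integrable_diff[OF assms(1,2)] square_integrable_diff[OF assms(2,3)]]
  by simp

lemma L2_norm_sq_nonneg [simp]: "L2_norm_sq M v \<ge> 0"
  by (simp add: L2_norm_sq_def)

context contractive_ifs
begin

lemma step_add: "step n (\<lambda>k. f k + g k) x = step n f x + step n g x"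
  by (simp add: step_def algebra_simps sum.distrib)

lemma step_cmult: "step n (\<lambda>k. c * f k) x = c * step n f x"
  by (simp add: step_def sum_distrib_left mult.assoc)

text \<open>Approximation is required at every sufficiently high level, not just at some level: this makes
  the notion stable under sums without refining step functions, and it leaves room to choose the level
  so large that given frequencies belong to \<open>Lambda_n\<close>.\<close>

definition step_approximable :: "(real ^ 'd \<Rightarrow> complex) \<Rightarrow> bool" where
  "step_approximable v \<longleftrightarrow> square_integrable \<mu> v \<and>
     (\<forall>e>0. \<forall>\<^sub>F n in sequentially. \<exists>f. L2_norm_sq \<mu> (\<lambda>x. v x - step n f x) < e)"

lemma step_approximable_closed:
  assumes v: "square_integrable \<mu> v"
    and approx: "\<And>e. e > 0 \<Longrightarrow> \<exists>w. step_approximable w \<and> L2_norm_sq \<mu> (\<lambda>x. v x - w x) < e"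
  shows "step_approximable v"
  unfolding step_approximable_def
proof (intro conjI v allI impI)
  fix e :: real assume "e > 0"
  then have e: "e / 4 > 0" by simp
  obtain w where w: "step_approximable w" "L2_norm_sq \<mu> (\<lambda>x. v x - w x) < e / 4"
    using approx[OF e] by blast
  have "\<forall>\<^sub>F n in sequentially. \<exists>f. L2_norm_sq \<mu> (\<lambda>x. w x - step n f x) < e / 4"
    using w(1) e unfolding step_approximable_def by blast
  then show "\<forall>\<^sub>F n in sequentially. \<exists>f. L2_norm_sq \<mu> (\<lambda>x. v x - step n f x) < e"
  proof eventually_elim
    case (elim n)
    then obtain f where "L2_norm_sq \<mu> (\<lambda>x. w x - step n f x) < e / 4" by blast
    then show ?case
      using w L2_norm_sq_triangle[OF v _ square_integrable_step, of w n f]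
      by (intro exI[of _ f]) (auto simp: step_approximable_def)
  qed
qed

lemma step_approximable_dominated_limit:
  assumes w: "\<And>i. step_approximable (w i)"
    and v: "square_integrable \<mu> v"
    and lim: "\<And>x. (\<lambda>i. w i x) \<longlonglongrightarrow> v x"
    and g: "integrable \<mu> g" "\<And>i x. (cmod (v x - w i x))\<^sup>2 \<le> g x"
  shows "step_approximable v"
proof (rule step_approximable_closed[OF v])
  fix e :: real assume "e > 0"
  have [measurable]: "v \<in> borel_measurable \<mu>" "w i \<in> borel_measurable \<mu>" for i
    using v w by (auto simp: square_integrable_def step_approximable_def)
  have "(\<lambda>i. LINT x|\<mu>. (cmod (v x - w i x))\<^sup>2) \<longlonglongrightarrow> (LINT x|\<mu>. 0)"
  proof (rule integral_dominated_convergence[where w = g])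
    have "(\<lambda>i. (cmod (v x - w i x))\<^sup>2) \<longlonglongrightarrow> (cmod (v x - v x))\<^sup>2" for x
      by (intro tendsto_intros lim)
    then show "AE x in \<mu>. (\<lambda>i. (cmod (v x - w i x))\<^sup>2) \<longlonglongrightarrow> 0" by simp
  qed (use g in simp_all)
  then have "\<forall>\<^sub>F i in sequentially. L2_norm_sq \<mu> (\<lambda>x. v x - w i x) < e"
    using \<open>e > 0\<close> by (intro order_tendstoD(2)[of _ 0]) (simp_all add: L2_norm_sq_def)
  then obtain i where "L2_norm_sq \<mu> (\<lambda>x. v x - w i x) < e"
    using eventually_happens by fastforce
  then show "\<exists>w. step_approximable w \<and> L2_norm_sq \<mu> (\<lambda>x. v x - w x) < e" using w by blast
qed

lemma step_approximable_add:
  assumes v: "step_approximable v" and w: "step_approximable w"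
  shows "step_approximable (\<lambda>x. v x + w x)"
  unfolding step_approximable_def
proof (intro conjI allI impI)
  show "square_integrable \<mu> (\<lambda>x. v x + w x)"
    using assms by (auto simp: step_approximable_def intro: square_integrable_add)
  fix e :: real assume "e > 0"
  then have e: "e / 4 > 0" by simp
  have "\<forall>\<^sub>F n in sequentially. \<exists>f. L2_norm_sq \<mu> (\<lambda>x. v x - step n f x) < e / 4"
    "\<forall>\<^sub>F n in sequentially. \<exists>f. L2_norm_sq \<mu> (\<lambda>x. w x - step n f x) < e / 4"
    using v w e unfolding step_approximable_def by blast+
  then show "\<forall>\<^sub>F n in sequentially. \<exists>f. L2_norm_sq \<mu> (\<lambda>x. v x + w x - step n f x) < e"
  proof eventually_elim
    case (elim n)
    then obtain f g where fg: "L2_norm_sq \<mu> (\<lambda>x. v x - step n f x) < e / 4"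
      "L2_norm_sq \<mu> (\<lambda>x. w x - step n g x) < e / 4" by blast
    have "L2_norm_sq \<mu> (\<lambda>x. (v x - step n f x) + (w x - step n g x))
        \<le> 2 * L2_norm_sq \<mu> (\<lambda>x. v x - step n f x) + 2 * L2_norm_sq \<mu> (\<lambda>x. w x - step n g x)"
      using v w by (intro square_integrable_add square_integrable_diff square_integrable_step)
        (auto simp: step_approximable_def)
    also have "\<dots> < e" using fg by simp
    finally show ?case
      by (intro exI[of _ "\<lambda>k. f k + g k"]) (simp add: step_add algebra_simps)
  qed
qed

lemma step_approximable_cmult:
  assumes v: "step_approximable v"
  shows "step_approximable (\<lambda>x. c * v x)"
  unfolding step_approximable_def
proof (intro conjI allI impI)
  have sq: "square_integrable \<mu> v" using v by (simp add: step_approximable_def)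
  then show "square_integrable \<mu> (\<lambda>x. c * v x)" by (rule square_integrable_cmult)
  fix e :: real assume "e > 0"
  then have e: "e / ((cmod c)\<^sup>2 + 1) > 0" by (simp add: add_nonneg_pos)
  then have "\<forall>\<^sub>F n in sequentially. \<exists>f. L2_norm_sq \<mu> (\<lambda>x. v x - step n f x) < e / ((cmod c)\<^sup>2 + 1)"
    using v by (simp add: step_approximable_def)
  then show "\<forall>\<^sub>F n in sequentially. \<exists>f. L2_norm_sq \<mu> (\<lambda>x. c * v x - step n f x) < e"
  proof eventually_elim
    case (elim n)
    then obtain f where f: "L2_norm_sq \<mu> (\<lambda>x. v x - step n f x) < e / ((cmod c)\<^sup>2 + 1)" by blast
    have "L2_norm_sq \<mu> (\<lambda>x. c * (v x - step n f x)) = (cmod c)\<^sup>2 * L2_norm_sq \<mu> (\<lambda>x. v x - step n f x)"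
      by (intro square_integrable_cmult square_integrable_diff square_integrable_step sq)
    also have "\<dots> \<le> ((cmod c)\<^sup>2 + 1) * L2_norm_sq \<mu> (\<lambda>x. v x - step n f x)"
      by (intro mult_right_mono) auto
    also have "\<dots> < e"
      using f by (simp add: pos_less_divide_eq add_nonneg_pos mult.commute)
    finally show ?case
      by (intro exI[of _ "\<lambda>k. c * f k"]) (simp add: step_cmult algebra_simps)
  qed
qed

lemma step_approximable_zero: "step_approximable (\<lambda>x. 0)"
proof -
  have "L2_norm_sq \<mu> (\<lambda>x. 0 - step n (\<lambda>_. 0) x) = 0" for n
    by (simp add: L2_norm_sq_def step_def)
  then show ?thesis
    by (auto simp: step_approximable_def square_integrable_def intro!: always_eventually exI[of _ "\<lambda>_. 0"])
qed

lemma step_approximable_sum: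
  assumes "\<And>i. i \<in> I \<Longrightarrow> step_approximable (v i)"
  shows "step_approximable (\<lambda>x. \<Sum>i\<in>I. v i x)"
  using assms
proof (induction I rule: infinite_finite_induct)
  case (insert i I)
  then show ?case by (simp add: step_approximable_add)
qed (simp_all add: step_approximable_zero)

text \<open>Sampling \<open>v\<close> at one point of each cell gives a uniformly small error, as the cells are small.\<close>

lemma step_approximable_lipschitz:
  assumes [measurable]: "v \<in> borel_measurable borel" and bound: "\<And>x. cmod (v x) \<le> c"
    and lip: "\<And>x y. cmod (v x - v y) \<le> L * dist x y" and L: "L > 0"
  shows "step_approximable v"
  unfolding step_approximable_def
proof (intro conjI allI impI)
  show "square_integrable \<mu> v" by (rule square_integrable_bounded[OF assms(1) bound])
  fix e :: real assume "e > 0"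
  \<comment> \<open>On cells of diameter at most \<open>r\<close> the squared error is at most \<open>(L * r)\<^sup>2 = e / 2\<close>.\<close>
  define r where "r = sqrt (e / 2) / L"
  have r: "r > 0" "(L * r)\<^sup>2 = e / 2" using \<open>e > 0\<close> L by (auto simp: r_def)
  obtain x0 where x0: "x0 \<in> X" using X_nonempty by blast
  show "\<forall>\<^sub>F n in sequentially. \<exists>f. L2_norm_sq \<mu> (\<lambda>x. v x - step n f x) < e"
    using eventually_cells_small[OF r(1)]
  proof eventually_elim
    case (elim n)
    define f where "f k = v (ifs_word R k x0)" for k
    have int: "integrable \<mu> (\<lambda>x. (cmod (v x - step n f x))\<^sup>2)"
      using square_integrable_diff[OF square_integrable_bounded[OF assms(1) bound] square_integrable_step]
      by (simp add: square_integrable_def)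
    have "(real (card B) ^ n) *\<^sub>R L2_norm_sq \<mu> (\<lambda>x. v x - step n f x)
        = (\<Sum>k\<in>words B n. LINT x|\<mu>. (cmod (v (ifs_word R k x) - f k))\<^sup>2)"
      unfolding L2_norm_sq_def
      using integral_step_words[of "\<lambda>c x. (cmod (v x - c))\<^sup>2" n f] int by simp
    also have "\<dots> \<le> (\<Sum>k\<in>words B n. (L * r)\<^sup>2)"
    proof (rule sum_mono)
      fix k assume k: "k \<in> words B n"
      have "AE x in \<mu>. (cmod (v (ifs_word R k x) - f k))\<^sup>2 \<le> (L * r)\<^sup>2"
        using AE_in_X
      proof eventually_elim
        case (elim x)
        then have "dist (ifs_word R k x) (ifs_word R k x0) \<le> r"
          using \<open>\<forall>k\<in>words B n. \<forall>x\<in>X. \<forall>y\<in>X. dist (ifs_word R k x) (ifs_word R k y) < r\<close> k x0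
          by (meson less_imp_le)
        then have "cmod (v (ifs_word R k x) - f k) \<le> L * r"
          unfolding f_def using lip L by (meson less_imp_le mult_left_mono order_trans)
        then show ?case by (intro power_mono) auto
      qed
      moreover have "integrable \<mu> (\<lambda>x. (cmod (v (ifs_word R k x) - f k))\<^sup>2)"
      proof (rule integrable_bounded[where c = "(c + c)\<^sup>2"])
        show "norm ((cmod (v (ifs_word R k x) - f k))\<^sup>2) \<le> (c + c)\<^sup>2" for x
        proof -
          have "cmod (v (ifs_word R k x) - f k) \<le> c + c"
            unfolding f_def using norm_triangle_ineq4[of "v (ifs_word R k x)" "v (ifs_word R k x0)"]
              bound[of "ifs_word R k x"] bound[of "ifs_word R k x0"] by linarith
          then have "(cmod (v (ifs_word R k x) - f k))\<^sup>2 \<le> (c + c)\<^sup>2"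
            by (intro power_mono) auto
          then show ?thesis by simp
        qed
      qed measurable
      ultimately have "(LINT x|\<mu>. (cmod (v (ifs_word R k x) - f k))\<^sup>2) \<le> (LINT x|\<mu>. (L * r)\<^sup>2)"
        by (intro integral_mono_AE) auto
      then show "(LINT x|\<mu>. (cmod (v (ifs_word R k x) - f k))\<^sup>2) \<le> (L * r)\<^sup>2"
        by (simp add: prob_space[unfolded space_mu])
    qed
    also have "\<dots> = real (card B) ^ n * (e / 2)"
      using r by (simp add: card_words)
    finally have "L2_norm_sq \<mu> (\<lambda>x. v x - step n f x) \<le> e / 2"
      using card_B_pos by simp
    then show ?case using \<open>e > 0\<close> by (intro exI[of _ f]) simp
  qed
qed

lemma step_approximable_indicator_closed:
  assumes C: "closed C"
  shows "step_approximable (indicator C)"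
proof (cases "C = {}")
  case True
  then have "indicator C = (\<lambda>x. 0 :: complex)" by auto
  then show ?thesis using step_approximable_zero by simp
next
  case False
  have [measurable]: "C \<in> sets borel" using C by simp
  show ?thesis
    \<comment> \<open>The index is shifted so that the Lipschitz constant is positive.\<close>
  proof (rule step_approximable_dominated_limit[where w = "\<lambda>j x. complex_of_real (tent C (Suc j) x)" and g = "\<lambda>_. 1"])
    show "step_approximable (\<lambda>x. complex_of_real (tent C (Suc j) x))" for j
    proof (rule step_approximable_lipschitz[where c = 1 and L = "real (Suc j)"])
      show "(\<lambda>x. complex_of_real (tent C (Suc j) x)) \<in> borel_measurable borel"
        by (intro borel_measurable_continuous_onI continuous_intros)
      show "cmod (complex_of_real (tent C (Suc j) x) - complex_of_real (tent C (Suc j) y)) \<le> real (Suc j) * dist x y" for x y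
        using tent_lipschitz[of C "Suc j" x y] by (metis norm_of_real of_real_diff)
    qed (use tent_bounds[of C] in simp_all)
    show "square_integrable \<mu> (indicator C)"
      by (rule square_integrable_bounded[where c = 1]) (auto simp: indicator_def)
    show "(\<lambda>j. complex_of_real (tent C (Suc j) x)) \<longlonglongrightarrow> indicator C x" for x
      using tendsto_of_real[OF LIMSEQ_Suc[OF tent_tendsto_indicator[OF C False]], where 'a = complex]
      by (simp add: of_real_indicator)
    fix j x
    have "cmod (indicator C x - complex_of_real (tent C (Suc j) x)) = \<bar>indicator C x - tent C (Suc j) x\<bar>"
      by (metis norm_of_real of_real_diff of_real_indicator)
    also have "\<dots> \<le> 1"
      using tent_bounds[of C "Suc j" x] by (auto simp: indicator_def)
    finally show "(cmod (indicator C x - complex_of_real (tent C (Suc j) x)))\<^sup>2 \<le> 1"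
      by (simp add: power_le_one)
  qed simp
qed

text \<open>By inner regularity, a Borel set differs little from a compact subset.\<close>

lemma step_approximable_indicator:
  assumes E [measurable]: "E \<in> sets borel"
  shows "step_approximable (indicator E)"
proof (rule step_approximable_closed)
  show "square_integrable \<mu> (indicator E)"
    by (rule square_integrable_bounded[where c = 1]) (auto simp: indicator_def)
  fix e :: real assume "e > 0"
  have "emeasure \<mu> E = (SUP K \<in> {K. K \<subseteq> E \<and> compact K}. emeasure \<mu> K)"
    using inner_regular[of \<mu> E] E by (simp add: emeasure_eq_measure)
  then have "\<exists>K. K \<subseteq> E \<and> compact K \<and> measure \<mu> E < measure \<mu> K + e"
  proof (cases "measure \<mu> E = 0")
    case True
    then show ?thesis using \<open>e > 0\<close> by (intro exI[of _ "{}"]) simp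
  next
    case False
    assume eq: "emeasure \<mu> E = (SUP K \<in> {K. K \<subseteq> E \<and> compact K}. emeasure \<mu> K)"
    have "measure \<mu> E > 0" using False by (simp add: order.not_eq_order_implies_strict)
    then have "ennreal (measure \<mu> E - e) < emeasure \<mu> E"
      using \<open>e > 0\<close> by (simp add: emeasure_eq_measure ennreal_lessI)
    then obtain K where "K \<subseteq> E" "compact K" "ennreal (measure \<mu> E - e) < emeasure \<mu> K"
      unfolding eq by (auto simp: less_SUP_iff)
    moreover then have "measure \<mu> E - e < measure \<mu> K"
      by (metis emeasure_eq_measure ennreal_leI not_le)
    ultimately show ?thesis by (intro exI[of _ K]) auto
  qed
  then obtain K where K: "K \<subseteq> E" "compact K" "measure \<mu> E < measure \<mu> K + e" by blast
  then have [measurable]: "K \<in> sets borel" by (simp add: borel_closed compact_imp_closed)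
  have "(cmod (indicator E x - indicator K x))\<^sup>2 = indicator (E - K) x" for x
    using K by (auto simp: indicator_def)
  then have "L2_norm_sq \<mu> (\<lambda>x. indicator E x - indicator K x) = measure \<mu> (E - K)"
    by (simp add: L2_norm_sq_def)
  also have "\<dots> < e"
    using K finite_measure_Diff[of E K] by simp
  finally show "\<exists>w. step_approximable w \<and> L2_norm_sq \<mu> (\<lambda>x. indicator E x - w x) < e"
    using step_approximable_indicator_closed[OF compact_imp_closed[OF K(2)]] by blast
qed

text \<open>Simple functions, which are finite combinations of indicators, converge to \<open>v\<close> with twice its
  modulus as a common bound.\<close>

lemma step_approximable_square_integrable:
  assumes v: "square_integrable \<mu> v"
  shows "step_approximable v"
proof -
  have "v \<in> borel_measurable \<mu>" and int: "integrable \<mu> (\<lambda>x. (cmod (v x))\<^sup>2)"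
    using v by (auto simp: square_integrable_def)
  from borel_measurable_implies_sequence_metric[OF this(1), of 0]
  obtain s where s: "\<And>i. simple_function \<mu> (s i)" "\<And>x. (\<lambda>i. s i x) \<longlonglongrightarrow> v x"
    and bound: "\<And>i x. cmod (s i x) \<le> 2 * cmod (v x)"
    by auto
  show ?thesis
  proof (rule step_approximable_dominated_limit[where w = s and g = "\<lambda>x. 9 * (cmod (v x))\<^sup>2"])
    show "step_approximable (s i)" for i
    proof -
      have fin: "finite (range (s i))" using simple_functionD(1)[OF s(1)[of i]] by simp
      have "s i -` {y} \<in> sets borel" for y
        using simple_functionD(2)[OF s(1)[of i], of "{y}"] by simp
      then have "step_approximable (\<lambda>x. \<Sum>y\<in>range (s i). y * indicator (s i -` {y}) x)"
        by (intro step_approximable_sum step_approximable_cmult step_approximable_indicator)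
      moreover have "(\<Sum>y\<in>range (s i). y * indicator (s i -` {y}) x) = s i x" for x
      proof -
        have "(\<Sum>y\<in>range (s i). y * indicator (s i -` {y}) x) = (\<Sum>y\<in>range (s i). if y = s i x then y else 0)"
          by (intro sum.cong) (auto simp: indicator_def)
        then show ?thesis using fin by simp
      qed
      ultimately show ?thesis by simp
    qed
    show "(cmod (v x - s i x))\<^sup>2 \<le> 9 * (cmod (v x))\<^sup>2" for i x
    proof -
      have "cmod (v x - s i x) \<le> 3 * cmod (v x)"
        using norm_triangle_ineq4[of "v x" "s i x"] bound[of i x] by simp
      then have "(cmod (v x - s i x))\<^sup>2 \<le> (3 * cmod (v x))\<^sup>2" by (intro power_mono) auto
      then show ?thesis by (simp add: power_mult_distrib)
    qed
  qed (use v int s in simp_all)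
qed

end

section \<open>Frame bounds\<close>

lemma summable_on_ennreal: "(f :: 'a \<Rightarrow> ennreal) summable_on S"
  by (rule nonneg_summable_on_complete) simp

lemma infsum_ennreal_cmult:
  fixes g :: "'a \<Rightarrow> real"
  assumes "c \<ge> 0"
  shows "(\<Sum>\<^sub>\<infinity>l\<in>S. ennreal (c * g l)) = ennreal c * (\<Sum>\<^sub>\<infinity>l\<in>S. ennreal (g l))"
proof -
  have "sum (\<lambda>l. ennreal c * ennreal (g l)) = (\<lambda>F. ennreal c * sum (\<lambda>l. ennreal (g l)) F)"
    by (simp add: fun_eq_iff sum_distrib_left)
  moreover have "((\<lambda>l. ennreal (g l)) has_sum (\<Sum>\<^sub>\<infinity>l\<in>S. ennreal (g l))) S"
    by (rule has_sum_infsum[OF summable_on_ennreal])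
  ultimately have "((\<lambda>l. ennreal c * ennreal (g l)) has_sum ennreal c * (\<Sum>\<^sub>\<infinity>l\<in>S. ennreal (g l))) S"
    unfolding has_sum_def by (simp only:) (rule ennreal_tendsto_cmult, simp_all)
  then show ?thesis
    using assms by (simp add: ennreal_mult' infsumI)
qed

context contractive_ifs
begin

lemma integrable_square_integrable:
  assumes "square_integrable \<mu> v"
  shows "integrable \<mu> v"
proof (rule Bochner_Integration.integrable_bound[where f = "\<lambda>x. 1 + (cmod (v x))\<^sup>2"])
  show "integrable \<mu> (\<lambda>x. 1 + (cmod (v x))\<^sup>2)" and "v \<in> borel_measurable \<mu>"
    using assms by (auto simp: square_integrable_def)
  have "t \<le> 1 + t\<^sup>2" for t :: real
  proof -
    have "2 * t \<le> 1 + t\<^sup>2" using sum_squares_bound[of 1 t] by simp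
    then show ?thesis using zero_le_power2[of t] by linarith
  qed
  then show "AE x in \<mu>. norm (v x) \<le> norm (1 + (cmod (v x))\<^sup>2)" by simp
qed

lemma integrable_mult_expo:
  assumes "integrable \<mu> v"
  shows "integrable \<mu> (\<lambda>x. v x * cnj (expo l x))"
proof (rule Bochner_Integration.integrable_bound[OF assms])
  have [measurable]: "v \<in> borel_measurable borel"
    using borel_measurable_integrable[OF assms] by simp
  show "(\<lambda>x. v x * cnj (expo l x)) \<in> borel_measurable \<mu>" by measurable
qed (simp add: norm_mult)

text \<open>Cauchy--Schwarz for a probability measure and a function of modulus \<open>1\<close>; it is the
  nonnegativity of the variance of \<open>\<bar>v\<bar>\<close>.\<close>

lemma L2_inner_expo_le:
  assumes v: "square_integrable \<mu> v"
  shows "(cmod (L2_inner \<mu> v (expo l)))\<^sup>2 \<le> L2_norm_sq \<mu> v"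
proof -
  have int: "integrable \<mu> (\<lambda>x. cmod (v x))" "integrable \<mu> (\<lambda>x. (cmod (v x))\<^sup>2)"
    using integrable_square_integrable[OF v] v by (auto simp: square_integrable_def)
  define c where "c = (LINT x|\<mu>. cmod (v x))"
  have "cmod (L2_inner \<mu> v (expo l)) \<le> (LINT x|\<mu>. cmod (v x * cnj (expo l x)))"
    unfolding L2_inner_def by (rule integral_norm_bound)
  then have "cmod (L2_inner \<mu> v (expo l)) \<le> c" by (simp add: norm_mult c_def)
  then have "(cmod (L2_inner \<mu> v (expo l)))\<^sup>2 \<le> c\<^sup>2" by (intro power_mono) auto
  also have "c\<^sup>2 \<le> L2_norm_sq \<mu> v"
  proof -
    have "0 \<le> variance (\<lambda>x. cmod (v x))" by (rule variance_positive)
    then show ?thesis using int by (simp add: variance_eq c_def L2_norm_sq_def)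
  qed
  finally show ?thesis .
qed

lemma L2_inner_sq_le:
  assumes v: "square_integrable \<mu> v" and w: "square_integrable \<mu> w"
  shows "(cmod (L2_inner \<mu> v (expo l)))\<^sup>2
    \<le> 2 * (cmod (L2_inner \<mu> w (expo l)))\<^sup>2 + 2 * (cmod (L2_inner \<mu> (\<lambda>x. v x - w x) (expo l)))\<^sup>2"
proof -
  have "L2_inner \<mu> v (expo l) = L2_inner \<mu> w (expo l) + L2_inner \<mu> (\<lambda>x. v x - w x) (expo l)"
    using integrable_mult_expo[OF integrable_square_integrable[OF v], of l]
      integrable_mult_expo[OF integrable_square_integrable[OF w], of l]
    by (simp add: L2_inner_def algebra_simps)
  then show ?thesis using norm_add_sq_le by metis
qed

lemma norm_fourier_transform_le: "cmod (fourier_transform \<mu> x) \<le> 1"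
proof -
  have "cmod (fourier_transform \<mu> x) \<le> (LINT t|\<mu>. cmod (expo x t))"
    unfolding fourier_transform_def expo_def by (rule integral_norm_bound)
  then show ?thesis by (simp add: prob_space[unfolded space_mu])
qed

lemma eventually_in_Lambda_n:
  assumes "l \<in> \<Lambda>" "r0 > 0"
  shows "\<forall>\<^sub>F n in sequentially. l \<in> Lambda_n R \<Lambda> r0 n"
proof -
  have "(\<lambda>n. ((\<lambda>x. matrix_inv (transpose R) *v x) ^^ n) l) \<longlonglongrightarrow> 0"
    unfolding matrix_inv_transpose[OF invertible]
    by (rule transpose_powers_tendsto_zero[OF powers_tendsto_zero])
  then have "(\<lambda>n. norm (((\<lambda>x. matrix_inv (transpose R) *v x) ^^ n) l)) \<longlonglongrightarrow> 0"
    by (rule tendsto_norm_zero)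
  then have "\<forall>\<^sub>F n in sequentially. norm (((\<lambda>x. matrix_inv (transpose R) *v x) ^^ n) l) < r0"
    using assms(2) by (rule order_tendstoD)
  then show ?thesis
    by eventually_elim (use assms(1) in \<open>simp add: Lambda_n_def\<close>)
qed

lemma step_upper_bound:
  assumes "A_norm_sq R B \<Lambda> r0 n f \<le> ennreal (M * word_norm_sq B n f)"
  shows "(\<Sum>\<^sub>\<infinity>l\<in>Lambda_n R \<Lambda> r0 n. ennreal ((cmod (L2_inner \<mu> (step n f) (expo l)))\<^sup>2))
    \<le> ennreal (M * L2_norm_sq \<mu> (step n f))"
proof -
  define K where "K = real (card B) ^ n"
  have K: "K > 0" using card_B_pos by (simp add: K_def)
  have "(cmod (L2_inner \<mu> (step n f) (expo l)))\<^sup>2 \<le> 1 / K * (cmod (A_apply R B n f l))\<^sup>2" for l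
  proof -
    have "(cmod (A_apply R B n f l))\<^sup>2
        * (cmod (fourier_transform \<mu> (((\<lambda>x. matrix_inv (transpose R) *v x) ^^ n) l)))\<^sup>2
      \<le> (cmod (A_apply R B n f l))\<^sup>2"
      using norm_fourier_transform_le by (intro mult_left_le power_le_one) auto
    then show ?thesis
      using K unfolding L2_inner_step K_def[symmetric] by (simp add: divide_right_mono)
  qed
  then have "(\<Sum>\<^sub>\<infinity>l\<in>Lambda_n R \<Lambda> r0 n. ennreal ((cmod (L2_inner \<mu> (step n f) (expo l)))\<^sup>2))
      \<le> (\<Sum>\<^sub>\<infinity>l\<in>Lambda_n R \<Lambda> r0 n. ennreal (1 / K * (cmod (A_apply R B n f l))\<^sup>2))"
    by (intro infsum_mono summable_on_ennreal ennreal_leI)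
  also have "\<dots> = ennreal (1 / K) * A_norm_sq R B \<Lambda> r0 n f"
    using K unfolding A_norm_sq_def by (intro infsum_ennreal_cmult) simp
  also have "\<dots> \<le> ennreal (1 / K) * ennreal (M * word_norm_sq B n f)"
    using assms by (intro mult_left_mono) auto
  also have "\<dots> = ennreal (1 / K * (M * word_norm_sq B n f))"
    using K by (intro ennreal_mult'[symmetric]) simp
  also have "1 / K * (M * word_norm_sq B n f) = M * L2_norm_sq \<mu> (step n f)"
    using K L2_norm_sq_step[of n f] by (simp add: field_simps flip: K_def)
  finally show ?thesis .
qed

lemma step_lower_bound:
  assumes lower: "ennreal (m * word_norm_sq B n f) \<le> A_norm_sq R B \<Lambda> r0 n f"
    and \<delta>: "\<delta> \<ge> 0" "\<And>x. norm x \<le> r0 \<Longrightarrow> \<delta> \<le> cmod (fourier_transform \<mu> x)"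
  shows "ennreal (\<delta>\<^sup>2 * m * L2_norm_sq \<mu> (step n f))
    \<le> (\<Sum>\<^sub>\<infinity>l\<in>Lambda_n R \<Lambda> r0 n. ennreal ((cmod (L2_inner \<mu> (step n f) (expo l)))\<^sup>2))"
proof -
  define K where "K = real (card B) ^ n"
  have K: "K > 0" using card_B_pos by (simp add: K_def)
  have le: "\<delta>\<^sup>2 / K * (cmod (A_apply R B n f l))\<^sup>2 \<le> (cmod (L2_inner \<mu> (step n f) (expo l)))\<^sup>2"
    if "l \<in> Lambda_n R \<Lambda> r0 n" for l
  proof -
    have "\<delta>\<^sup>2 \<le> (cmod (fourier_transform \<mu> (((\<lambda>x. matrix_inv (transpose R) *v x) ^^ n) l)))\<^sup>2"
      using that \<delta> by (intro power_mono) (auto simp: Lambda_n_def)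
    then have "(cmod (A_apply R B n f l))\<^sup>2 * \<delta>\<^sup>2 \<le> (cmod (A_apply R B n f l))\<^sup>2
        * (cmod (fourier_transform \<mu> (((\<lambda>x. matrix_inv (transpose R) *v x) ^^ n) l)))\<^sup>2"
      by (intro mult_left_mono) auto
    then show ?thesis
      using K unfolding L2_inner_step K_def[symmetric] by (simp add: divide_right_mono mult.commute)
  qed
  have "\<delta>\<^sup>2 * m * L2_norm_sq \<mu> (step n f) = \<delta>\<^sup>2 / K * (m * word_norm_sq B n f)"
    using K L2_norm_sq_step[of n f] by (simp add: field_simps flip: K_def)
  moreover have "ennreal (\<delta>\<^sup>2 / K * (m * word_norm_sq B n f)) = ennreal (\<delta>\<^sup>2 / K) * ennreal (m * word_norm_sq B n f)"
    using K by (intro ennreal_mult') simp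
  ultimately have "ennreal (\<delta>\<^sup>2 * m * L2_norm_sq \<mu> (step n f)) = ennreal (\<delta>\<^sup>2 / K) * ennreal (m * word_norm_sq B n f)"
    by (simp only:)
  also have "\<dots> \<le> ennreal (\<delta>\<^sup>2 / K) * A_norm_sq R B \<Lambda> r0 n f"
    using lower by (intro mult_left_mono) auto
  also have "\<dots> = (\<Sum>\<^sub>\<infinity>l\<in>Lambda_n R \<Lambda> r0 n. ennreal (\<delta>\<^sup>2 / K * (cmod (A_apply R B n f l))\<^sup>2))"
    using K unfolding A_norm_sq_def by (intro infsum_ennreal_cmult[symmetric]) simp
  also have "\<dots> \<le> (\<Sum>\<^sub>\<infinity>l\<in>Lambda_n R \<Lambda> r0 n. ennreal ((cmod (L2_inner \<mu> (step n f) (expo l)))\<^sup>2))"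
    using le by (intro infsum_mono summable_on_ennreal ennreal_leI)
  finally show ?thesis .
qed

text \<open>A finite set \<open>F\<close> of frequencies is contained in \<open>Lambda_n\<close> for large \<open>n\<close>, so the bound for step
  functions applies to \<open>F\<close>. Replacing the step function by \<open>v\<close> costs an error proportional to
  \<open>card F\<close>, which is harmless because \<open>F\<close> is fixed while the approximation improves.\<close>

lemma frame_upper_bound:
  assumes r0: "r0 > 0" and M: "M > 0"
    and upper: "\<And>n f. n \<ge> 1 \<Longrightarrow> A_norm_sq R B \<Lambda> r0 n f \<le> ennreal (M * word_norm_sq B n f)"
    and v: "square_integrable \<mu> v"
  shows "(\<Sum>\<^sub>\<infinity>l\<in>\<Lambda>. ennreal ((cmod (L2_inner \<mu> v (expo l)))\<^sup>2)) \<le> ennreal (4 * M * L2_norm_sq \<mu> v)"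
proof (rule infsum_le_finite_sums[OF summable_on_ennreal])
  fix F assume F: "finite F" "F \<subseteq> \<Lambda>"
  define T where "T w l = (cmod (L2_inner \<mu> w (expo l)))\<^sup>2" for w l
  define C where "C = 4 * M + 2 * real (card F)"
  have "C > 0" using M by (simp add: C_def add_pos_nonneg)
  have "sum (T v) F \<le> 4 * M * L2_norm_sq \<mu> v + e" if "e > 0" for e
  proof -
    have e': "e / C > 0" using \<open>C > 0\<close> that by simp
    have "\<forall>\<^sub>F n in sequentially. n \<ge> 1 \<and> (\<forall>l\<in>F. l \<in> Lambda_n R \<Lambda> r0 n)
        \<and> (\<exists>f. L2_norm_sq \<mu> (\<lambda>x. v x - step n f x) < e / C)"
      using step_approximable_square_integrable[OF v] e' F r0
      unfolding step_approximable_def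
      by (intro eventually_conj eventually_ge_at_top eventually_ball_finite ballI eventually_in_Lambda_n) auto
    then obtain n f where n: "n \<ge> 1" "F \<subseteq> Lambda_n R \<Lambda> r0 n"
      and f: "L2_norm_sq \<mu> (\<lambda>x. v x - step n f x) < e / C"
      using eventually_happens by fastforce
    define s where "s = step n f"
    define d where "d = L2_norm_sq \<mu> (\<lambda>x. v x - s x)"
    have s: "square_integrable \<mu> s" unfolding s_def by (rule square_integrable_step)
    have "ennreal (sum (T s) F) = (\<Sum>\<^sub>\<infinity>l\<in>F. ennreal (T s l))"
      using F by (simp add: T_def)
    also have "\<dots> \<le> (\<Sum>\<^sub>\<infinity>l\<in>Lambda_n R \<Lambda> r0 n. ennreal (T s l))"
      by (rule infsum_mono_neutral[OF summable_on_ennreal summable_on_ennreal]) (use n in auto)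
    also have "\<dots> \<le> ennreal (M * L2_norm_sq \<mu> s)"
      unfolding T_def s_def by (rule step_upper_bound[OF upper[OF n(1)]])
    finally have Ts: "sum (T s) F \<le> M * L2_norm_sq \<mu> s"
      using M by simp
    have "sum (T v) F \<le> (\<Sum>l\<in>F. 2 * T s l + 2 * d)"
    proof (rule sum_mono)
      fix l assume "l \<in> F"
      show "T v l \<le> 2 * T s l + 2 * d"
        using L2_inner_sq_le[OF v s, of l] L2_inner_expo_le[OF square_integrable_diff[OF v s], of l]
        unfolding T_def d_def by linarith
    qed
    also have "\<dots> = 2 * sum (T s) F + 2 * real (card F) * d"
      by (simp add: sum.distrib sum_distrib_left)
    also have "\<dots> \<le> 2 * (M * L2_norm_sq \<mu> s) + 2 * real (card F) * d"
      using Ts by simp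
    also have "L2_norm_sq \<mu> s \<le> 2 * L2_norm_sq \<mu> v + 2 * d"
    proof -
      have "L2_norm_sq \<mu> s = L2_norm_sq \<mu> (\<lambda>x. v x + - 1 * (v x - s x))" by simp
      also have "\<dots> \<le> 2 * L2_norm_sq \<mu> v + 2 * L2_norm_sq \<mu> (\<lambda>x. - 1 * (v x - s x))"
        by (intro square_integrable_add square_integrable_cmult square_integrable_diff v s)
      finally show ?thesis
        using square_integrable_cmult(2)[OF square_integrable_diff[OF v s], of "-1"] by (simp add: d_def)
    qed
    finally have "sum (T v) F \<le> 4 * M * L2_norm_sq \<mu> v + C * d"
      using M by (simp add: C_def algebra_simps)
    moreover have "C * d \<le> e"
      using f \<open>C > 0\<close> by (simp add: d_def s_def field_simps)
    ultimately show ?thesis by simp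
  qed
  then have "sum (T v) F \<le> 4 * M * L2_norm_sq \<mu> v" by (rule field_le_epsilon)
  then have "ennreal (sum (T v) F) \<le> ennreal (4 * M * L2_norm_sq \<mu> v)" by (rule ennreal_leI)
  then show "(\<Sum>l\<in>F. ennreal ((cmod (L2_inner \<mu> v (expo l)))\<^sup>2)) \<le> ennreal (4 * M * L2_norm_sq \<mu> v)"
    by (simp add: T_def)
qed

text \<open>Here the set \<open>Lambda_n\<close> changes with the level and its size is not bounded, so an error bound for
  single frequencies would not do; the approximation error is controlled over all of \<open>\<Lambda>\<close> by the
  upper bound.\<close>

lemma frame_lower_bound:
  assumes r0: "r0 > 0" and M: "M > 0" and m: "m > 0" and \<delta>: "\<delta> > 0"
    and fourier: "\<And>x. norm x \<le> r0 \<Longrightarrow> \<delta> \<le> cmod (fourier_transform \<mu> x)"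
    and upper: "\<And>n f. n \<ge> 1 \<Longrightarrow> A_norm_sq R B \<Lambda> r0 n f \<le> ennreal (M * word_norm_sq B n f)"
    and lower: "\<And>n f. n \<ge> 1 \<Longrightarrow> ennreal (m * word_norm_sq B n f) \<le> A_norm_sq R B \<Lambda> r0 n f"
    and v: "square_integrable \<mu> v"
  shows "ennreal (\<delta>\<^sup>2 * m / 4 * L2_norm_sq \<mu> v)
    \<le> (\<Sum>\<^sub>\<infinity>l\<in>\<Lambda>. ennreal ((cmod (L2_inner \<mu> v (expo l)))\<^sup>2))"
proof -
  define T where "T w l = (cmod (L2_inner \<mu> w (expo l)))\<^sup>2" for w l
  have T_nonneg: "T w l \<ge> 0" for w l by (simp add: T_def)
  have T_upper: "(\<Sum>\<^sub>\<infinity>l\<in>\<Lambda>. ennreal (T w l)) \<le> ennreal (4 * M * L2_norm_sq \<mu> w)"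
    if "square_integrable \<mu> w" for w
    unfolding T_def by (rule frame_upper_bound[OF r0 M upper that])
  obtain \<sigma> where \<sigma>: "\<sigma> \<ge> 0" "(\<Sum>\<^sub>\<infinity>l\<in>\<Lambda>. ennreal (T v l)) = ennreal \<sigma>"
    using T_upper[OF v] by (metis ennreal_cases ennreal_neq_top top.extremum_unique)
  define q where "q = \<delta>\<^sup>2 * m"
  have q: "q > 0" using \<delta> m by (simp add: q_def)
  define C where "C = 16 * M + 2 * q"
  have "C > 0" using M q by (simp add: C_def)
  have "q * L2_norm_sq \<mu> v \<le> 4 * \<sigma> + e" if "e > 0" for e
  proof -
    have e': "e / C > 0" using \<open>C > 0\<close> that by simp
    have "\<forall>\<^sub>F n in sequentially. n \<ge> 1 \<and> (\<exists>f. L2_norm_sq \<mu> (\<lambda>x. v x - step n f x) < e / C)"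
      using step_approximable_square_integrable[OF v] e'
      unfolding step_approximable_def
      by (intro eventually_conj eventually_ge_at_top) auto
    then obtain n f where n: "n \<ge> 1"
      and f: "L2_norm_sq \<mu> (\<lambda>x. v x - step n f x) < e / C"
      using eventually_happens by fastforce
    define s where "s = step n f"
    have s: "square_integrable \<mu> s" unfolding s_def by (rule square_integrable_step)
    define u where "u x = s x - v x" for x
    have u: "square_integrable \<mu> u" unfolding u_def by (rule square_integrable_diff[OF s v])
    define d where "d = L2_norm_sq \<mu> u"
    have d: "L2_norm_sq \<mu> (\<lambda>x. v x - s x) = d" "d \<ge> 0"
      using square_integrable_cmult(2)[OF u, of "-1"] by (simp_all add: u_def d_def)
    have "ennreal (q * L2_norm_sq \<mu> s) \<le> (\<Sum>\<^sub>\<infinity>l\<in>Lambda_n R \<Lambda> r0 n. ennreal (T s l))"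
      unfolding T_def s_def q_def
      by (rule step_lower_bound[OF lower[OF n] less_imp_le[OF \<delta>] fourier])
    also have "\<dots> \<le> (\<Sum>\<^sub>\<infinity>l\<in>\<Lambda>. ennreal (2 * T v l) + ennreal (2 * T u l))"
    proof (rule infsum_mono_neutral[OF summable_on_ennreal summable_on_ennreal])
      fix l
      have "T s l \<le> 2 * T v l + 2 * T u l"
        using L2_inner_sq_le[OF s v, of l] by (simp add: T_def u_def[abs_def])
      then show "ennreal (T s l) \<le> ennreal (2 * T v l) + ennreal (2 * T u l)"
        using T_nonneg by (simp add: ennreal_leI flip: ennreal_plus)
    qed (auto simp: Lambda_n_def)
    also have "\<dots> = ennreal 2 * (\<Sum>\<^sub>\<infinity>l\<in>\<Lambda>. ennreal (T v l)) + ennreal 2 * (\<Sum>\<^sub>\<infinity>l\<in>\<Lambda>. ennreal (T u l))"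
      by (simp only: infsum_add[OF summable_on_ennreal summable_on_ennreal] infsum_ennreal_cmult zero_le_numeral)
    also have "\<dots> \<le> ennreal 2 * ennreal \<sigma> + ennreal 2 * ennreal (4 * M * d)"
      using T_upper[OF u] \<sigma> unfolding d_def by (intro add_mono mult_left_mono) auto
    also have "\<dots> = ennreal (2 * \<sigma>) + ennreal (2 * (4 * M * d))"
      by (simp only: ennreal_mult' zero_le_numeral)
    also have "\<dots> = ennreal (2 * \<sigma> + 8 * M * d)"
      using \<sigma> M d by (subst ennreal_plus[symmetric]) auto
    finally have "ennreal (q * L2_norm_sq \<mu> s) \<le> ennreal (2 * \<sigma> + 8 * M * d)" .
    moreover have "0 \<le> 2 * \<sigma> + 8 * M * d" using \<sigma> M d by simp
    ultimately have "q * L2_norm_sq \<mu> s \<le> 2 * \<sigma> + 8 * M * d"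
      by (simp only: ennreal_le_iff)
    moreover have "L2_norm_sq \<mu> v \<le> 2 * L2_norm_sq \<mu> s + 2 * d"
      using square_integrable_add(2)[OF s square_integrable_diff[OF v s]] d by simp
    then have "q * L2_norm_sq \<mu> v \<le> q * (2 * L2_norm_sq \<mu> s + 2 * d)"
      using q by simp
    ultimately have "q * L2_norm_sq \<mu> v \<le> 4 * \<sigma> + C * d"
      by (simp add: C_def algebra_simps)
    moreover have "C * d \<le> e"
      using f \<open>C > 0\<close> d by (simp add: s_def field_simps)
    ultimately show ?thesis by simp
  qed
  then have "q * L2_norm_sq \<mu> v \<le> 4 * \<sigma>" by (rule field_le_epsilon)
  then have "ennreal (\<delta>\<^sup>2 * m / 4 * L2_norm_sq \<mu> v) \<le> ennreal \<sigma>"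
    by (intro ennreal_leI) (simp add: q_def)
  then show ?thesis using \<sigma> by (simp add: T_def)
qed

end

theorem theorem3p9:
  fixes R :: "real ^ 'd ^ 'd"
    and B X \<Lambda> :: "(real ^ 'd) set"
    and \<mu> :: "(real ^ 'd) measure"
    and N :: nat
    and r0 \<delta> m M :: real
  assumes "integer_matrix R" and "expansive R"
    and "\<forall>b\<in>B. integer_vector b" and "card B = N" and "N \<ge> 2"
    and "invariant_measure R B \<mu>"
    and "attractor R B X" and "no_overlap R B X \<mu>"
    and "topological_space_class.discrete \<Lambda>"
    and "r0 > 0" and "\<delta> > 0"
    and "\<forall>x. norm x \<le> r0 \<longrightarrow> cmod (fourier_transform \<mu> x) \<ge> \<delta>"
    and "m > 0" and "M > 0"
    and "\<forall>n\<ge>1. \<forall>f :: (real ^ 'd) list \<Rightarrow> complex.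
           ennreal (m * word_norm_sq B n f) \<le> A_norm_sq R B \<Lambda> r0 n f \<and>
           A_norm_sq R B \<Lambda> r0 n f \<le> ennreal (M * word_norm_sq B n f)"
  shows "frame_spectrum \<mu> \<Lambda>"
proof -
  interpret contractive_ifs R B X \<mu>
  proof
    show "invertible R" using expansive_imp_invertible assms(2) .
    show "(\<lambda>k. ((\<lambda>x. matrix_inv R *v x) ^^ k) x) \<longlonglongrightarrow> 0" for x
      using expansive_inverse_powers_tendsto_zero assms(2) .
    show "finite B" "B \<noteq> {}" using assms(4,5) card.infinite by fastforce+
  qed (use assms in simp_all)
  have upper: "A_norm_sq R B \<Lambda> r0 n f \<le> ennreal (M * word_norm_sq B n f)"
    and lower: "ennreal (m * word_norm_sq B n f) \<le> A_norm_sq R B \<Lambda> r0 n f" if "n \<ge> 1" for n f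
    using assms(15) that by blast+
  have fourier: "\<delta> \<le> cmod (fourier_transform \<mu> x)" if "norm x \<le> r0" for x
    using assms(12) that by blast
  show ?thesis
    unfolding frame_spectrum_def
  proof (intro exI conjI allI impI)
    show "\<delta>\<^sup>2 * m / 4 > 0" "4 * M > 0" using assms by simp_all
    fix v assume v: "square_integrable \<mu> v"
    show "ennreal (\<delta>\<^sup>2 * m / 4 * L2_norm_sq \<mu> v)
        \<le> (\<Sum>\<^sub>\<infinity>l\<in>\<Lambda>. ennreal ((cmod (L2_inner \<mu> v (expo l)))\<^sup>2))"
      by (rule frame_lower_bound[OF assms(10,14,13,11) fourier upper lower v])
    show "(\<Sum>\<^sub>\<infinity>l\<in>\<Lambda>. ennreal ((cmod (L2_inner \<mu> v (expo l)))\<^sup>2))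
        \<le> ennreal (4 * M * L2_norm_sq \<mu> v)"
      by (rule frame_upper_bound[OF assms(10,14) upper v])
  qed
qed

end
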